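(* Let $K\in(0,M]$, $k\in[M]$ and $A\subseteq[M]$. Suppose that, with $g_i:=\log(f_{1i}/f_{0i})$, $$\sum_{i=1}^M\int_{\mathbb S}|g_i|\log^+(|g_i|)\,f_{1i}\,d\nu_i<\infty,\qquad \sum_{i=1}^M\int_{\mathbb S}|g_i|\log^+(|g_i|)\,f_{0i}\,d\nu_i<\infty .$$ Then, as $\alpha\to0$, $$\mathcal J_A(\alpha;k,K)\gtrsim\frac{|\log\alpha|}{V(k,K,\boldsymbol F(A))}.$$
   Context: Notation. $\mathbb N=\{1,2,\dots\}$, $\mathbb N_0=\mathbb N\cup\{0\}$, $[n]=\{1,\dots,n\}$; $\triangle$ is symmetric difference; $x\gtrsim y$ means $\liminf (x/y)\ge1$. Model. Let $M\in\mathbb N$ and let $(\mathbb S,\mathcal S)$ be a measurable space. There are $M$ sequences $\{X_i(n):n\in\mathbb N\}$, $i\in[M]$, of iid $\mathbb S$-valued random elements ("sources") and $M$ sequences $\{Z_i(n):n\in\mathbb N_0\}$, $i\in[M]$, of iid random variables uniform on $(0,1)$ (used for randomization); all of these are mutually independent. For $A\subseteq[M]$ (the set of "anomalous" sources), $\mathsf P_A$ (expectation $\mathsf E_A$) is the probability measure under which $X_i(n)$ has density $f_{1i}$ with respect to a $\sigma$-finite measure $\nu_i$ if $i\in A$, and density $f_{0i}$ if $i\notin A$. Standing assumption: for every $i\in[M]$, $I_i:=\int_{\mathbb S}\log(f_{1i}/f_{0i})f_{1i}\,d\nu_i\in(0,\infty)$ and $J_i:=\int_{\mathbb S}\log(f_{0i}/f_{1i})f_{0i}\,d\nu_i\in(0,\infty)$.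 Policies. A sampling rule is a sequence $R=\{R(n):n\in\mathbb N\}$ of random subsets of $[M]$ with $R(n)$ being $\mathcal F^R_{n-1}$-measurable, where $\mathcal F^R_0=\sigma(Z(0))$, $\mathcal F^R_n=\sigma(\mathcal F^R_{n-1},Z(n),\{X_i(n):i\in R(n)\})$ and $Z(n)=(Z_1(n),\dots,Z_M(n))$. A policy is a triplet $(R,T,\Delta)$ with $R$ a sampling rule, $T$ an $\{\mathcal F^R_n\}$-stopping time, and $\Delta\subseteq[M]$ random and $\mathcal F^R_T$-measurable. For $K\in(0,M]$, $\mathcal C(K)$ is the class of policies with $\frac1T\sum_{m=1}^T|R(m)|\le K$. Error control. For $k\in[M]$, $\alpha\in(0,1)$, $\mathcal C(\alpha;k,K)$ is the class of policies in $\mathcal C(K)$ with $\mathsf P_B(|B\triangle\Delta|\ge k)\le\alpha$ for all $B\subseteq[M]$, and $\mathcal J_A(\alpha;k,K):=\inf_{(R,T,\Delta)\in\mathcal C(\alpha;k,K)}\mathsf E_A[T]$. The constant $V$. For an ordered set $\boldsymbol L=\{L_1\le\dots\le L_{|\boldsymbol L|}\}$ of positive numbers (repetitions allowed) with $|\boldsymbol L|\le M$ and $\kappa\in[|\boldsymbol L|]$, $$V(\kappa,K,\boldsymbol L):=\max_{(c_1,\dots,c_M)\in\mathcal D(K)}\ \min_{U\subseteq[|\boldsymbol L|],\,|U|=\kappa}\ \sum_{i\in U}c_iL_i,\qquad \mathcal D(K):=\Big\{c\in[0,1]^M:\sum_{i=1}^Mc_i\le K\Big\}.$$ $\boldsymbol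 F(A):=\{F_i(A):i\in[M]\}$ is the ordered set consisting of the $M$ numbers $I_i$, $i\in A$, and $J_j$, $j\notin A$, with $F_i(A)$ the $i$-th smallest. *)

theory Defs
  imports "HOL-Probability.Probability"
begin

section \<open>Integrals of extended-real log-likelihood ratios\<close>

text \<open>The logarithm with values in \<open>[-\<infinity>, \<infinity>]\<close>.  Note that \<open>ln 0 = 0\<close> and \<open>x / 0 = 0\<close> for
  type \<open>real\<close>, so the real-valued \<open>ln (a / b)\<close> would silently hide the points
  where exactly one of the two densities vanishes.\<close>

definition elog :: "ereal \<Rightarrow> ereal" where
  "elog x = (if x \<le> 0 then - \<infinity> else if x = \<infinity> then \<infinity> else ereal (ln (real_of_ereal x)))"

definition elog_plus :: "ereal \<Rightarrow> ereal" where
  "elog_plus x = max 0 (elog x)"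

text \<open>The Lebesgue integral of an extended-real function, as the difference of the integrals of
  the positive and the negative part (\<open>e2ennreal\<close> sends negative values to \<open>0\<close>).  In HOL
  \<open>\<infinity> - \<infinity> = \<infinity>\<close> on \<open>ereal\<close>, so a finite value means that both parts are finite.\<close>

definition eintegral :: "'s measure \<Rightarrow> ('s \<Rightarrow> ereal) \<Rightarrow> ereal" where
  "eintegral N h =
     enn2ereal (\<integral>\<^sup>+x. e2ennreal (h x) \<partial>N) - enn2ereal (\<integral>\<^sup>+x. e2ennreal (- h x) \<partial>N)"

definition llr :: "('s \<Rightarrow> real) \<Rightarrow> ('s \<Rightarrow> real) \<Rightarrow> 's \<Rightarrow> ereal" where
  "llr f g x = elog (ereal (f x) / ereal (g x))"

definition KL_info :: "'s measure \<Rightarrow> ('s \<Rightarrow> real) \<Rightarrow> ('s \<Rightarrow> real) \<Rightarrow> ereal" where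
  "KL_info N f g = eintegral N (\<lambda>x. llr f g x * ereal (f x))"

section \<open>The model\<close>

locale anomaly_model =
  fixes M :: nat
    and S :: "'s measure"
    and \<nu> :: "nat \<Rightarrow> 's measure"
    and f0 f1 :: "nat \<Rightarrow> 's \<Rightarrow> real"
    and \<Omega> :: "'w measure"
    and P :: "nat set \<Rightarrow> 'w measure"
    and X :: "nat \<Rightarrow> nat \<Rightarrow> 'w \<Rightarrow> 's"
    and Z :: "nat \<Rightarrow> nat \<Rightarrow> 'w \<Rightarrow> real"
  assumes M_pos: "1 \<le> M"
    and sets_\<nu>: "\<And>i. i \<in> {1..M} \<Longrightarrow> sets (\<nu> i) = sets S"
    and sigma_finite_\<nu>: "\<And>i. i \<in> {1..M} \<Longrightarrow> sigma_finite_measure (\<nu> i)"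
    and f0_nonneg: "\<And>i x. i \<in> {1..M} \<Longrightarrow> x \<in> space S \<Longrightarrow> 0 \<le> f0 i x"
    and f1_nonneg: "\<And>i x. i \<in> {1..M} \<Longrightarrow> x \<in> space S \<Longrightarrow> 0 \<le> f1 i x"
    and f0_measurable: "\<And>i. i \<in> {1..M} \<Longrightarrow> f0 i \<in> borel_measurable S"
    and f1_measurable: "\<And>i. i \<in> {1..M} \<Longrightarrow> f1 i \<in> borel_measurable S"
    and prob_space_P: "\<And>A. A \<subseteq> {1..M} \<Longrightarrow> prob_space (P A)"
    and sets_P: "\<And>A. A \<subseteq> {1..M} \<Longrightarrow> sets (P A) = sets \<Omega>"
    and X_anomalous: "\<And>A i n. A \<subseteq> {1..M} \<Longrightarrow> i \<in> A \<Longrightarrow> 1 \<le> n \<Longrightarrow>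
          distributed (P A) (\<nu> i) (X i n) (\<lambda>x. ennreal (f1 i x))"
    and X_normal: "\<And>A i n. A \<subseteq> {1..M} \<Longrightarrow> i \<in> {1..M} - A \<Longrightarrow> 1 \<le> n \<Longrightarrow>
          distributed (P A) (\<nu> i) (X i n) (\<lambda>x. ennreal (f0 i x))"
    and Z_measurable: "\<And>i n. i \<in> {1..M} \<Longrightarrow> Z i n \<in> borel_measurable \<Omega>"
    and Z_uniform: "\<And>A i n. A \<subseteq> {1..M} \<Longrightarrow> i \<in> {1..M} \<Longrightarrow>
          distr (P A) lborel (Z i n) = uniform_measure lborel {0<..<1}"
    \<comment> \<open>Mutual independence of all \<open>X\<^sub>i(n)\<close>, \<open>n \<ge> 1\<close>, and all \<open>Z\<^sub>i(n)\<close>, \<open>n \<ge> 0\<close>;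
      stated with \<open>indep_sets\<close> because \<open>indep_vars\<close> needs a single value type.\<close>
    and independent: "\<And>A. A \<subseteq> {1..M} \<Longrightarrow>
          prob_space.indep_sets (P A)
            (case_sum
              (\<lambda>(i, n). {X i n -` B \<inter> space \<Omega> | B. B \<in> sets S})
              (\<lambda>(i, n). {Z i n -` B \<inter> space \<Omega> | B. B \<in> sets borel}))
            (({1..M} \<times> {1..}) <+> ({1..M} \<times> UNIV))"
    and I_range: "\<And>i. i \<in> {1..M} \<Longrightarrow> 0 < KL_info (\<nu> i) (f1 i) (f0 i) \<and> KL_info (\<nu> i) (f1 i) (f0 i) < \<infinity>"
    and J_range: "\<And>i. i \<in> {1..M} \<Longrightarrow> 0 < KL_info (\<nu> i) (f0 i) (f1 i) \<and> KL_info (\<nu> i) (f0 i) (f1 i) < \<infinity>"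

section \<open>Policies\<close>

text \<open>\<open>obs_filtration\<close> is \<open>\<F>\<^sup>R\<^sub>n\<close>.  As the set \<open>R(n)\<close> is random, observing
  \<open>{X\<^sub>i(n) : i \<in> R(n)}\<close> means observing the events \<open>{i \<in> R(n), X\<^sub>i(n) \<in> B}\<close>.\<close>

primrec obs_filtration ::
  "nat \<Rightarrow> 's measure \<Rightarrow> 'w measure \<Rightarrow> (nat \<Rightarrow> nat \<Rightarrow> 'w \<Rightarrow> 's) \<Rightarrow> (nat \<Rightarrow> nat \<Rightarrow> 'w \<Rightarrow> real) \<Rightarrow>
   (nat \<Rightarrow> 'w \<Rightarrow> nat set) \<Rightarrow> nat \<Rightarrow> 'w measure" where
  "obs_filtration M S \<Omega> X Z R 0 =
     sigma (space \<Omega>) {Z i 0 -` B \<inter> space \<Omega> | i B. i \<in> {1..M} \<and> B \<in> sets borel}"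
| "obs_filtration M S \<Omega> X Z R (Suc n) =
     sigma (space \<Omega>)
       (sets (obs_filtration M S \<Omega> X Z R n)
        \<union> {Z i (Suc n) -` B \<inter> space \<Omega> | i B. i \<in> {1..M} \<and> B \<in> sets borel}
        \<union> {{\<omega> \<in> space \<Omega>. i \<in> R (Suc n) \<omega> \<and> X i (Suc n) \<omega> \<in> B} | i B. i \<in> {1..M} \<and> B \<in> sets S})"

text \<open>Stopping times take values in \<open>\<nat>\<^sub>0 \<union> {\<infinity>}\<close>, hence the filtration is extended to the index
  \<open>\<infinity>\<close>, so that \<open>stopping_time\<close> and \<open>filtration.pre_sigma\<close> (that is, \<open>\<F>\<^sup>R\<^sub>T\<close>) apply.\<close>

definition obs_filtration_enat ::
  "nat \<Rightarrow> 's measure \<Rightarrow> 'w measure \<Rightarrow> (nat \<Rightarrow> nat \<Rightarrow> 'w \<Rightarrow> 's) \<Rightarrow> (nat \<Rightarrow> nat \<Rightarrow> 'w \<Rightarrow> real) \<Rightarrow>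
   (nat \<Rightarrow> 'w \<Rightarrow> nat set) \<Rightarrow> enat \<Rightarrow> 'w measure" where
  "obs_filtration_enat M S \<Omega> X Z R t =
     (case t of enat n \<Rightarrow> obs_filtration M S \<Omega> X Z R n
      | \<infinity> \<Rightarrow> sigma (space \<Omega>) (\<Union>n. sets (obs_filtration M S \<Omega> X Z R n)))"

lemma space_obs_filtration [simp]: "space (obs_filtration M S \<Omega> X Z R n) = space \<Omega>"
proof (cases n)
  case 0
  then show ?thesis by (auto simp: space_measure_of_conv)
next
  case (Suc n)
  then show ?thesis by (simp add: space_measure_of_conv)
qed

lemma sets_obs_filtration_Suc:
  "sets (obs_filtration M S \<Omega> X Z R n) \<subseteq> sets (obs_filtration M S \<Omega> X Z R (Suc n))"
proof -
  let ?G = "sets (obs_filtration M S \<Omega> X Z R n)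
        \<union> {Z i (Suc n) -` B \<inter> space \<Omega> | i B. i \<in> {1..M} \<and> B \<in> sets borel}
        \<union> {{\<omega> \<in> space \<Omega>. i \<in> R (Suc n) \<omega> \<and> X i (Suc n) \<omega> \<in> B} | i B. i \<in> {1..M} \<and> B \<in> sets S}"
  have "?G \<subseteq> Pow (space \<Omega>)"
    using sets.space_closed[of "obs_filtration M S \<Omega> X Z R n"] by auto
  then have "sets (obs_filtration M S \<Omega> X Z R (Suc n)) = sigma_sets (space \<Omega>) ?G"
    by (simp add: sets_measure_of)
  then show ?thesis by auto
qed

lemma filtration_obs_filtration_enat:
  "filtration (space \<Omega>) (obs_filtration_enat M S \<Omega> X Z R)"
proof
  fix t :: enat
  show "space (obs_filtration_enat M S \<Omega> X Z R t) = space \<Omega>"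
    by (cases t) (simp_all add: obs_filtration_enat_def space_measure_of_conv)
next
  fix s t :: enat
  assume st: "s \<le> t"
  let ?F = "obs_filtration M S \<Omega> X Z R"
  have mono: "sets (?F m) \<subseteq> sets (?F n)" if "m \<le> n" for m n
    by (rule lift_Suc_mono_le[OF _ that]) (rule sets_obs_filtration_Suc)
  have "(\<Union>n. sets (?F n)) \<subseteq> Pow (space \<Omega>)"
    using sets.space_closed[of "?F _"] by auto
  then have inf: "sets (obs_filtration_enat M S \<Omega> X Z R \<infinity>) =
      sigma_sets (space \<Omega>) (\<Union>n. sets (?F n))"
    by (simp add: obs_filtration_enat_def sets_measure_of)
  show "sets (obs_filtration_enat M S \<Omega> X Z R s) \<subseteq> sets (obs_filtration_enat M S \<Omega> X Z R t)"
  proof (cases t)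
    case (enat n)
    then obtain m where "s = enat m" "m \<le> n"
      using st by (cases s) auto
    then show ?thesis
      using mono enat by (simp add: obs_filtration_enat_def)
  next
    case infinity
    show ?thesis
    proof (cases s)
      case (enat m)
      then have "sets (obs_filtration_enat M S \<Omega> X Z R s) = sets (?F m)"
        by (simp add: obs_filtration_enat_def)
      then show ?thesis
        using infinity inf by auto
    qed (simp add: infinity)
  qed
qed

definition sampling_rule ::
  "nat \<Rightarrow> 's measure \<Rightarrow> 'w measure \<Rightarrow> (nat \<Rightarrow> nat \<Rightarrow> 'w \<Rightarrow> 's) \<Rightarrow> (nat \<Rightarrow> nat \<Rightarrow> 'w \<Rightarrow> real) \<Rightarrow>
   (nat \<Rightarrow> 'w \<Rightarrow> nat set) \<Rightarrow> bool" where
  "sampling_rule M S \<Omega> X Z R \<longleftrightarrow>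
     (\<forall>n\<ge>1. R n \<in> obs_filtration M S \<Omega> X Z R (n - 1) \<rightarrow>\<^sub>M count_space (Pow {1..M}))"

definition policy ::
  "nat \<Rightarrow> 's measure \<Rightarrow> 'w measure \<Rightarrow> (nat \<Rightarrow> nat \<Rightarrow> 'w \<Rightarrow> 's) \<Rightarrow> (nat \<Rightarrow> nat \<Rightarrow> 'w \<Rightarrow> real) \<Rightarrow>
   (nat \<Rightarrow> 'w \<Rightarrow> nat set) \<Rightarrow> ('w \<Rightarrow> enat) \<Rightarrow> ('w \<Rightarrow> nat set) \<Rightarrow> bool" where
  "policy M S \<Omega> X Z R T \<Delta> \<longleftrightarrow>
     sampling_rule M S \<Omega> X Z R \<and>
     stopping_time (obs_filtration_enat M S \<Omega> X Z R) T \<and>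
     \<Delta> \<in> filtration.pre_sigma (space \<Omega>) (obs_filtration_enat M S \<Omega> X Z R) T
           \<rightarrow>\<^sub>M count_space (Pow {1..M})"

text \<open>The class \<open>\<C>(K)\<close>.  The pathwise budget constraint between random variables is
  understood almost surely, under each \<open>P\<^sub>B\<close>; it is meaningful only where \<open>1 \<le> T < \<infinity>\<close>.\<close>

definition budget_policies ::
  "nat \<Rightarrow> 's measure \<Rightarrow> 'w measure \<Rightarrow> (nat set \<Rightarrow> 'w measure) \<Rightarrow> (nat \<Rightarrow> nat \<Rightarrow> 'w \<Rightarrow> 's) \<Rightarrow>
   (nat \<Rightarrow> nat \<Rightarrow> 'w \<Rightarrow> real) \<Rightarrow> real \<Rightarrow>
   ((nat \<Rightarrow> 'w \<Rightarrow> nat set) \<times> ('w \<Rightarrow> enat) \<times> ('w \<Rightarrow> nat set)) set" where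
  "budget_policies M S \<Omega> P X Z K =
     {(R, T, \<Delta>). policy M S \<Omega> X Z R T \<Delta> \<and>
        (\<forall>B\<subseteq>{1..M}. AE \<omega> in P B. \<forall>n\<ge>1. T \<omega> = enat n \<longrightarrow>
            1 / real n * (\<Sum>m = 1..n. real (card (R m \<omega>))) \<le> K)}"

text \<open>The class \<open>\<C>(\<alpha>; k, K)\<close>.\<close>

definition admissible_policies ::
  "nat \<Rightarrow> 's measure \<Rightarrow> 'w measure \<Rightarrow> (nat set \<Rightarrow> 'w measure) \<Rightarrow> (nat \<Rightarrow> nat \<Rightarrow> 'w \<Rightarrow> 's) \<Rightarrow>
   (nat \<Rightarrow> nat \<Rightarrow> 'w \<Rightarrow> real) \<Rightarrow> real \<Rightarrow> nat \<Rightarrow> real \<Rightarrow>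
   ((nat \<Rightarrow> 'w \<Rightarrow> nat set) \<times> ('w \<Rightarrow> enat) \<times> ('w \<Rightarrow> nat set)) set" where
  "admissible_policies M S \<Omega> P X Z \<alpha> k K =
     {(R, T, \<Delta>). (R, T, \<Delta>) \<in> budget_policies M S \<Omega> P X Z K \<and>
        (\<forall>B\<subseteq>{1..M}. measure (P B) {\<omega> \<in> space \<Omega>. k \<le> card (sym_diff B (\<Delta> \<omega>))} \<le> \<alpha>)}"

text \<open>\<open>\<J>\<^sub>A(\<alpha>; k, K)\<close>, equal to \<open>\<infinity>\<close> if there is no admissible policy.\<close>

definition optimal_time ::
  "nat \<Rightarrow> 's measure \<Rightarrow> 'w measure \<Rightarrow> (nat set \<Rightarrow> 'w measure) \<Rightarrow> (nat \<Rightarrow> nat \<Rightarrow> 'w \<Rightarrow> 's) \<Rightarrow>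
   (nat \<Rightarrow> nat \<Rightarrow> 'w \<Rightarrow> real) \<Rightarrow> nat set \<Rightarrow> real \<Rightarrow> nat \<Rightarrow> real \<Rightarrow> ennreal" where
  "optimal_time M S \<Omega> P X Z A \<alpha> k K =
     (INF (R, T, \<Delta>) \<in> admissible_policies M S \<Omega> P X Z \<alpha> k K. \<integral>\<^sup>+\<omega>. ennreal_of_enat (T \<omega>) \<partial>P A)"

section \<open>The constant \<open>V\<close>\<close>

definition budget_vectors :: "nat \<Rightarrow> real \<Rightarrow> (nat \<Rightarrow> real) set" where
  "budget_vectors M K = {c. (\<forall>i\<in>{1..M}. 0 \<le> c i \<and> c i \<le> 1) \<and> (\<Sum>i = 1..M. c i) \<le> K}"

definition min_weight :: "nat \<Rightarrow> real list \<Rightarrow> (nat \<Rightarrow> real) \<Rightarrow> real" where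
  "min_weight \<kappa> L c =
     Min ((\<lambda>U. \<Sum>i\<in>U. c i * L ! (i - 1)) ` {U. U \<subseteq> {1..length L} \<and> card U = \<kappa>})"

text \<open>The ordered set \<open>L\<close> is a sorted list.  The supremum is attained, see
  \<open>V_is_max\<close> below.\<close>

definition V :: "nat \<Rightarrow> nat \<Rightarrow> real \<Rightarrow> real list \<Rightarrow> real" where
  "V M \<kappa> K L = (SUP c\<in>budget_vectors M K. min_weight \<kappa> L c)"

definition F_list ::
  "nat \<Rightarrow> (nat \<Rightarrow> 's measure) \<Rightarrow> (nat \<Rightarrow> 's \<Rightarrow> real) \<Rightarrow> (nat \<Rightarrow> 's \<Rightarrow> real) \<Rightarrow> nat set \<Rightarrow> real list" where
  "F_list M \<nu> f0 f1 A =
     sort (map (\<lambda>i. if i \<in> A then real_of_ereal (KL_info (\<nu> i) (f1 i) (f0 i))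
                    else real_of_ereal (KL_info (\<nu> i) (f0 i) (f1 i))) [1..<M + 1])"

lemma continuous_on_Min_image:
  fixes g :: "'i \<Rightarrow> 'c::topological_space \<Rightarrow> real"
  assumes "finite I" "I \<noteq> {}" "\<And>i. i \<in> I \<Longrightarrow> continuous_on C (g i)"
  shows "continuous_on C (\<lambda>c. Min ((\<lambda>i. g i c) ` I))"
  using assms
proof (induction I rule: finite_ne_induct)
  case (insert i I)
  then have "continuous_on C (\<lambda>c. min (g i c) (Min ((\<lambda>i. g i c) ` I)))"
    by (intro continuous_on_min) auto
  then show ?case using insert by simp
qed simp

lemma V_is_max:
  assumes "0 < K" "\<kappa> \<le> length L" "length L \<le> M"
  shows "\<exists>c\<in>budget_vectors M K. V M \<kappa> K L = min_weight \<kappa> L c \<and>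
           (\<forall>d\<in>budget_vectors M K. min_weight \<kappa> L d \<le> min_weight \<kappa> L c)"
proof -
  let ?C = "PiE UNIV (\<lambda>i. if i \<in> {1..M} then {0..1} else {0}) :: (nat \<Rightarrow> real) set"
  let ?D = "?C \<inter> {c. (\<Sum>i = 1..M. c i) \<le> K}"
  let ?\<U> = "{U. U \<subseteq> {1..length L} \<and> card U = \<kappa>}"
  have coord: "continuous_on C (\<lambda>c::nat \<Rightarrow> real. c i)" for C i
    by (rule continuous_on_product_coordinates[THEN continuous_on_subset]) simp
  have "compactin (product_topology (\<lambda>i. euclidean) UNIV) ?C"
    unfolding compactin_PiE by auto
  then have C: "compact ?C"
    by (simp add: euclidean_product_topology)
  have "closed {c::nat \<Rightarrow> real. (\<Sum>i = 1..M. c i) \<le> K}"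
    by (intro closed_Collect_le continuous_on_sum coord continuous_on_const)
  with C have D: "compact ?D"
    by (rule compact_Int_closed)
  have "(\<lambda>_. 0) \<in> ?D" using assms by auto
  then have ne: "?D \<noteq> {}" by blast
  obtain U where "U \<subseteq> {1..length L}" "card U = \<kappa>"
    using assms by (metis card_atLeastAtMost diff_Suc_1 obtain_subset_with_card_n)
  then have U: "?\<U> \<noteq> {}" "finite ?\<U>" by auto
  have "continuous_on ?D (min_weight \<kappa> L)"
    unfolding min_weight_def
    by (intro continuous_on_Min_image U continuous_on_sum continuous_on_mult coord continuous_on_const)
  from continuous_attains_sup[OF D ne this] obtain c where
    c: "c \<in> ?D" "\<And>d. d \<in> ?D \<Longrightarrow> min_weight \<kappa> L d \<le> min_weight \<kappa> L c" by auto
  have cB: "c \<in> budget_vectors M K"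
    using c(1) by (fastforce simp: budget_vectors_def PiE_def Pi_def split: if_splits)
  have le: "min_weight \<kappa> L d \<le> min_weight \<kappa> L c" if "d \<in> budget_vectors M K" for d
  proof -
    let ?d = "\<lambda>i. if i \<in> {1..M} then d i else 0"
    have "?d \<in> ?D" using that by (auto simp: budget_vectors_def)
    moreover have "min_weight \<kappa> L ?d = min_weight \<kappa> L d"
      unfolding min_weight_def using assms
      by (intro arg_cong[where f=Min] image_cong sum.cong refl) auto
    ultimately show ?thesis using c(2)[of ?d] by simp
  qed
  then have "V M \<kappa> K L = min_weight \<kappa> L c"
    unfolding V_def by (intro cSup_eq_maximum) (use cB in auto)
  with cB le show ?thesis by blast
qed

end

theory Submission
  imports Defs
begin

text \<open>The bound is proved path by path.  Fix \<open>A\<close> and a set \<open>U\<close> of \<open>k\<close> sources.  If a policy ends with a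
  decision that differs from \<open>A\<close> by a set \<open>D\<close> of fewer than \<open>k\<close> sources, then this decision differs from the
  alternative \<open>B\<close> obtained by flipping the sources \<open>U - D\<close> in \<open>A\<close> by \<open>U \<union> D\<close>
  (\<open>card_sym_diff_completed\<close>), hence is an error under \<open>P B\<close> and has probability at most \<open>\<alpha>\<close> there.
  By a change of measure on the observed filtration (\<open>lr_on_obs\<close>, \<open>wrong_decision_bound\<close>), with high
  probability under \<open>P A\<close> the log-likelihood ratio that the sources in \<open>U - D\<close> have accumulated at the time
  of stopping exceeds \<open>(1 - \<epsilon>) \<bar>ln \<alpha>\<bar>\<close>, simultaneously for all \<open>U\<close>, as there are only finitely many
  pairs \<open>(D, U)\<close>.

  On the other hand, up to an error that is small relative to the time horizon, the accumulated
  log-likelihood ratio of a source is its information number times the number of its samples.  This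
  is a weak law of large numbers that holds uniformly over all sampling rules and stopping times
  (\<open>predictable_weak_law\<close>), because sampling decisions and the event of not having stopped are predictable.
  The sampling frequencies of a path that obeys the budget lie in the polytope over which \<open>V\<close> is the
  maximum, so at time \<open>n\<close> some \<open>U\<close> of size \<open>k\<close> has information at most \<open>n V\<close>
  (\<open>path_information_bound\<close>), and its subset \<open>U - D\<close> has no more.

  The two facts are incompatible if \<open>n \<le> (1 - 2 \<epsilon>) \<bar>ln \<alpha>\<bar> / V\<close>.  Thus stopping that early has
  vanishing probability, uniformly over the admissible policies (\<open>early_stopping_vanishes\<close>), and the expected
  stopping time is asymptotically at least \<open>\<bar>ln \<alpha>\<bar> / V\<close>.\<close>

section \<open>Change of measure for one gated observation\<close>

text \<open>Transports independence of a \<open>\<sigma>\<close>-algebra \<open>F\<close> and the events of a random element \<open>Y\<close> to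
  functions of them.  The hypothesis speaks of events because \<open>indep_var\<close>
  forces a common value type, which \<open>Y\<close> and \<open>u\<close> need not have.\<close>

lemma (in prob_space) indep_var_of_indep_set:
  assumes spF: "space F = space M"
    and indep: "indep_set (sets F) {Y -` B \<inter> space M | B. B \<in> sets N}"
    and Y: "Y \<in> M \<rightarrow>\<^sub>M N" and u: "u \<in> F \<rightarrow>\<^sub>M M1" and v: "v \<in> N \<rightarrow>\<^sub>M M2"
  shows "indep_var M1 u M2 (\<lambda>\<omega>. v (Y \<omega>))"
proof -
  let ?u = "{u -` A \<inter> space M | A. A \<in> sets M1}"
  let ?v = "{(\<lambda>\<omega>. v (Y \<omega>)) -` A \<inter> space M | A. A \<in> sets M2}"
  have F: "sets F \<subseteq> events"
    by (rule indep_setD_ev1[OF indep])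
  have "subalgebra M F"
    using F spF by (simp add: subalgebra_def)
  then have uM: "u \<in> M \<rightarrow>\<^sub>M M1"
    using u measurable_from_subalg by blast
  have uF: "?u \<subseteq> sets F"
    using measurable_sets[OF u] spF by auto
  have vN: "?v \<subseteq> {Y -` B \<inter> space M | B. B \<in> sets N}"
  proof safe
    fix A assume "A \<in> sets M2"
    then have "v -` A \<inter> space N \<in> sets N"
      using v by (rule measurable_sets[rotated])
    moreover have "(\<lambda>\<omega>. v (Y \<omega>)) -` A \<inter> space M = Y -` (v -` A \<inter> space N) \<inter> space M"
      using measurable_space[OF Y] by auto
    ultimately show "\<exists>B. (\<lambda>\<omega>. v (Y \<omega>)) -` A \<inter> space M = Y -` B \<inter> space M \<and> B \<in> sets N"
      by blast
  qed
  have "indep_set ?u ?v"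
    unfolding indep_set_def
    by (rule indep_sets_mono_sets[OF indep[unfolded indep_set_def]])
       (use uF vN in \<open>simp split: bool.split\<close>)
  moreover have "Int_stable ?u"
    unfolding Int_stable_def
  proof safe
    fix A B assume "A \<in> sets M1" "B \<in> sets M1"
    then show "\<exists>C. u -` A \<inter> space M \<inter> (u -` B \<inter> space M) = u -` C \<inter> space M \<and> C \<in> sets M1"
      by (intro exI[of _ "A \<inter> B"]) auto
  qed
  moreover have "Int_stable ?v"
    unfolding Int_stable_def
  proof safe
    fix A B assume "A \<in> sets M2" "B \<in> sets M2"
    then show "\<exists>C. (\<lambda>\<omega>. v (Y \<omega>)) -` A \<inter> space M \<inter> ((\<lambda>\<omega>. v (Y \<omega>)) -` B \<inter> space M)
        = (\<lambda>\<omega>. v (Y \<omega>)) -` C \<inter> space M \<and> C \<in> sets M2"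
      by (intro exI[of _ "A \<inter> B"]) auto
  qed
  ultimately have "indep_set (sigma_sets (space M) ?u) (sigma_sets (space M) ?v)"
    by (rule indep_set_sigma_sets)
  then show ?thesis
    using uM measurable_compose[OF Y v] by (simp add: indep_var_eq)
qed

lemma (in prob_space) nn_integral_mult_of_indep_set:
  assumes "space F = space M"
    and "indep_set (sets F) {Y -` B \<inter> space M | B. B \<in> sets N}"
    and "Y \<in> M \<rightarrow>\<^sub>M N" and "u \<in> borel_measurable F" and "v \<in> borel_measurable N"
  shows "(\<integral>\<^sup>+\<omega>. u \<omega> * v (Y \<omega>) \<partial>M) = (\<integral>\<^sup>+\<omega>. u \<omega> \<partial>M) * (\<integral>\<^sup>+\<omega>. v (Y \<omega>) \<partial>M :: ennreal)"
proof -
  have "indep_var borel u borel (\<lambda>\<omega>. v (Y \<omega>))"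
    by (rule indep_var_of_indep_set[OF assms])
  then have "indep_vars (\<lambda>_. borel) (case_bool u (\<lambda>\<omega>. v (Y \<omega>))) UNIV"
    unfolding indep_var_def by (rule indep_vars_cong[THEN iffD1, rotated -1]) (auto split: bool.splits)
  from indep_vars_nn_integral[OF _ this] show ?thesis
    by (simp add: UNIV_bool mult.commute)
qed

text \<open>One step of the likelihood ratio recursion.  The \<open>\<sigma>\<close>-algebra \<open>F\<close> is what is known so far, \<open>G\<close> is
  the known event that the fresh observation \<open>Y\<close> is taken, and \<open>L\<close> is the density of \<open>P\<close> with respect
  to \<open>Q\<close> on \<open>F\<close>.  The sets \<open>E \<inter> G \<inter> Y -` B\<close> and \<open>E\<close> with \<open>E \<in> F\<close> form a generator that is stable under
  intersection; on it independence factorizes both measures, so the density on the enlarged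
  \<open>\<sigma>\<close>-algebra picks up the factor \<open>l (Y \<omega>)\<close> exactly where the gate is open.  Taking the
  observations one at a time is what keeps this generator so simple.\<close>

lemma change_of_measure_step:
  assumes P: "prob_space P" and Q: "prob_space Q" and PQ: "sets Q = sets P"
    and spF: "space F = space P"
    and Y: "Y \<in> P \<rightarrow>\<^sub>M N"
    and indepP: "prob_space.indep_set P (sets F) {Y -` B \<inter> space P | B. B \<in> sets N}"
    and indepQ: "prob_space.indep_set Q (sets F) {Y -` B \<inter> space Q | B. B \<in> sets N}"
    and L: "L \<in> borel_measurable F"
    and PL: "\<And>E. E \<in> sets F \<Longrightarrow> emeasure P E = (\<integral>\<^sup>+\<omega>. L \<omega> * indicator E \<omega> \<partial>Q)"
    and l: "l \<in> borel_measurable N"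
    and Pl: "\<And>B. B \<in> sets N \<Longrightarrow>
        emeasure P (Y -` B \<inter> space P) = (\<integral>\<^sup>+\<omega>. l (Y \<omega>) * indicator B (Y \<omega>) \<partial>Q)"
    and G: "G \<in> sets F"
  defines "F' \<equiv> sigma (space P) (sets F \<union> {G \<inter> Y -` B | B. B \<in> sets N})"
    and "L' \<equiv> \<lambda>\<omega>. L \<omega> * (if \<omega> \<in> G then l (Y \<omega>) else 1)"
  shows "sets F \<subseteq> sets F'" and "\<And>B. B \<in> sets N \<Longrightarrow> G \<inter> Y -` B \<in> sets F'"
    and "L' \<in> borel_measurable F'"
    and "\<And>E. E \<in> sets F' \<Longrightarrow> emeasure P E = (\<integral>\<^sup>+\<omega>. L' \<omega> * indicator E \<omega> \<partial>Q)"
proof -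
  interpret P: prob_space P by fact
  interpret Q: prob_space Q by fact
  have sp: "space Q = space P"
    using PQ by (rule sets_eq_imp_space_eq)
  have YQ: "Y \<in> Q \<rightarrow>\<^sub>M N"
    using Y by (simp cong: measurable_cong_sets add: PQ)
  let ?E = "sets F \<union> {G \<inter> Y -` B | B. B \<in> sets N}"
  have FP: "sets F \<subseteq> sets P"
    by (rule P.indep_setD_ev1[OF indepP])
  have GP: "G \<in> sets P" using G FP by auto
  have G_sub: "G \<subseteq> space P"
    using GP sets.sets_into_space by auto
  have E_Pow: "?E \<subseteq> Pow (space P)"
    using G_sub sets.space_closed[of F] spF by auto
  have setsF': "sets F' = sigma_sets (space P) ?E"
    unfolding F'_def using E_Pow by (rule sets_measure_of)
  have spF': "space F' = space P"
    unfolding F'_def by (simp add: space_measure_of_conv)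
  have YG: "G \<inter> Y -` B \<in> sets P" if "B \<in> sets N" for B
  proof -
    have "G \<inter> (Y -` B \<inter> space P) \<in> sets P"
      using measurable_sets[OF Y that] GP by auto
    also have "G \<inter> (Y -` B \<inter> space P) = G \<inter> Y -` B"
      using G_sub by auto
    finally show ?thesis .
  qed
  have F'P: "sets F' \<subseteq> sets P"
    unfolding setsF' using FP YG by (intro sets.sigma_sets_subset) auto
  show FF': "sets F \<subseteq> sets F'" and YF': "\<And>B. B \<in> sets N \<Longrightarrow> G \<inter> Y -` B \<in> sets F'"
    unfolding setsF' by auto
  have "(\<lambda>\<omega>. if \<omega> \<in> G then l (Y \<omega>) else 1) \<in> borel_measurable F'"
  proof (rule measurableI)
    fix C :: "ennreal set" assume C: "C \<in> sets borel"
    have "G \<inter> Y -` (l -` C \<inter> space N) \<in> sets F'"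
      using measurable_sets[OF l C] by (rule YF')
    moreover have "(if 1 \<in> C then space P - G else {}) \<in> sets F'"
      using sets.compl_sets[of G F'] G FF' spF' by auto
    moreover have "(\<lambda>\<omega>. if \<omega> \<in> G then l (Y \<omega>) else 1) -` C \<inter> space F'
        = (G \<inter> Y -` (l -` C \<inter> space N)) \<union> (if 1 \<in> C then space P - G else {})"
      using G_sub measurable_space[OF Y] by (auto simp: spF' split: if_splits)
    ultimately show "(\<lambda>\<omega>. if \<omega> \<in> G then l (Y \<omega>) else 1) -` C \<inter> space F' \<in> sets F'"
      by auto
  qed auto
  moreover have "L \<in> borel_measurable F'"
    using L FF' spF spF' measurable_from_subalg[of F' F] by (auto simp: subalgebra_def)
  ultimately show L': "L' \<in> borel_measurable F'"
    unfolding L'_def by measurable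
  have subP: "subalgebra P F'" and subQ: "subalgebra Q F'" and subQF: "subalgebra Q F"
    using F'P FP spF spF' sp PQ by (auto simp: subalgebra_def)
  then have L'Q: "L' \<in> borel_measurable Q"
    using L' measurable_from_subalg by blast
  have LQ: "L \<in> borel_measurable Q"
    using L subQF measurable_from_subalg by blast
  let ?D = "density Q L'"
  have gen: "emeasure P (E \<inter> G \<inter> Y -` B) = emeasure ?D (E \<inter> G \<inter> Y -` B)"
    if E: "E \<in> sets F" and B: "B \<in> sets N" for E B
  proof -
    have EG: "E \<inter> G \<in> sets F" using E G by auto
    have *: "E \<inter> G \<inter> Y -` B = (E \<inter> G) \<inter> (Y -` B \<inter> space P)"
      using G_sub by auto
    have in_P: "E \<inter> G \<inter> Y -` B \<in> sets Q"
      unfolding PQ * using EG FP measurable_sets[OF Y B] by auto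
    have "emeasure P (E \<inter> G \<inter> Y -` B) = emeasure P (E \<inter> G) * emeasure P (Y -` B \<inter> space P)"
    proof -
      have "Y -` B \<inter> space P \<in> {Y -` B \<inter> space P | B. B \<in> sets N}"
        using B by blast
      from P.indep_setD[OF indepP EG this] show ?thesis
        unfolding * by (simp add: P.emeasure_eq_measure ennreal_mult)
    qed
    also have "\<dots> = (\<integral>\<^sup>+\<omega>. L \<omega> * indicator (E \<inter> G) \<omega> \<partial>Q) * (\<integral>\<^sup>+\<omega>. l (Y \<omega>) * indicator B (Y \<omega>) \<partial>Q)"
      using PL[OF EG] Pl[OF B] by simp
    also have "\<dots> = (\<integral>\<^sup>+\<omega>. (L \<omega> * indicator (E \<inter> G) \<omega>) * (l (Y \<omega>) * indicator B (Y \<omega>)) \<partial>Q)"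
      using L EG l B spF sp
      by (intro Q.nn_integral_mult_of_indep_set[OF _ indepQ YQ, symmetric,
            where v="\<lambda>y. l y * indicator B y"]) auto
    also have "\<dots> = (\<integral>\<^sup>+\<omega>. L' \<omega> * indicator (E \<inter> G \<inter> Y -` B) \<omega> \<partial>Q)"
      by (intro nn_integral_cong) (auto simp: L'_def split: split_indicator)
    also have "\<dots> = emeasure ?D (E \<inter> G \<inter> Y -` B)"
      using in_P L'Q by (simp add: emeasure_density)
    finally show ?thesis .
  qed
  have genF: "emeasure P E = emeasure ?D E" if E: "E \<in> sets F" for E
  proof -
    have EP: "E \<in> sets P" using E FP by auto
    have G1: "E \<inter> G \<inter> Y -` space N = E \<inter> G"
      using G_sub measurable_space[OF Y] by auto
    have EmG: "E - G \<in> sets F" using E G by auto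
    have "emeasure P (E - G) = (\<integral>\<^sup>+\<omega>. L \<omega> * indicator (E - G) \<omega> \<partial>Q)"
      using PL[OF EmG] .
    also have "\<dots> = (\<integral>\<^sup>+\<omega>. L' \<omega> * indicator (E - G) \<omega> \<partial>Q)"
      by (intro nn_integral_cong) (auto simp: L'_def split: split_indicator)
    also have "\<dots> = emeasure ?D (E - G)"
      using EmG FP PQ L'Q by (subst emeasure_density) auto
    finally have "emeasure P (E - G) = emeasure ?D (E - G)" .
    moreover have "emeasure P (E \<inter> G) = emeasure ?D (E \<inter> G)"
      using gen[OF E sets.top[of N]] unfolding G1 .
    moreover have "E = (E \<inter> G) \<union> (E - G)" by auto
    moreover have "emeasure P ((E \<inter> G) \<union> (E - G)) = emeasure P (E \<inter> G) + emeasure P (E - G)"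
      using EP GP by (intro plus_emeasure[symmetric]) auto
    moreover have "emeasure ?D ((E \<inter> G) \<union> (E - G)) = emeasure ?D (E \<inter> G) + emeasure ?D (E - G)"
      using EP GP PQ by (intro plus_emeasure[symmetric]) auto
    ultimately show ?thesis by metis
  qed
  (* The generating family of F' is not stable under intersection; intersecting its
     gated members with the sets of F makes it so. *)
  let ?E2 = "sets F \<union> {E \<inter> G \<inter> Y -` B | E B. E \<in> sets F \<and> B \<in> sets N}"
  have E2_Pow: "?E2 \<subseteq> Pow (space P)"
    using G_sub sets.space_closed[of F] spF by auto
  have setsF'2: "sets F' = sigma_sets (space P) ?E2"
  proof
    have "?E \<subseteq> ?E2"
      using G by blast
    then show "sets F' \<subseteq> sigma_sets (space P) ?E2"
      unfolding setsF' by (rule sigma_sets_mono')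
    have "?E2 \<subseteq> sets F'"
    proof safe
      fix E B assume "E \<in> sets F" "B \<in> sets N"
      then have "E \<inter> (G \<inter> Y -` B) \<in> sets F'"
        using sets.Int[of E F' "G \<inter> Y -` B"] FF' YF' by blast
      then show "E \<inter> G \<inter> Y -` B \<in> sets F'"
        by (simp add: Int_assoc)
    qed (use FF' in auto)
    then show "sigma_sets (space P) ?E2 \<subseteq> sets F'"
      using spF' sets.sigma_sets_subset[of ?E2 F'] by simp
  qed
  have eq: "restr_to_subalg P F' = restr_to_subalg ?D F'"
  proof (rule measure_eqI_generator_eq[where A="\<lambda>_. space P" and E="?E2" and \<Omega>="space P"])
    show "Int_stable ?E2"
      unfolding Int_stable_def
    proof (intro ballI)
      fix a b assume a: "a \<in> ?E2" and b: "b \<in> ?E2"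
      have genI: "c \<in> ?E2" if "c = E \<inter> G \<inter> Y -` B" "E \<in> sets F" "B \<in> sets N" for c E B
        using that by (intro UnI2 CollectI exI[of _ E] exI[of _ B] conjI)
      from a show "a \<inter> b \<in> ?E2"
      proof (elim UnE CollectE exE conjE)
        assume aF: "a \<in> sets F"
        from b show ?thesis
        proof (elim UnE CollectE exE conjE)
          assume "b \<in> sets F"
          then show ?thesis using aF by (intro UnI1) auto
        next
          fix E B assume "b = E \<inter> G \<inter> Y -` B" "E \<in> sets F" "B \<in> sets N"
          then show ?thesis using aF by (intro genI[of _ "a \<inter> E" B]) auto
        qed
      next
        fix D C assume aDC: "a = D \<inter> G \<inter> Y -` C" "D \<in> sets F" "C \<in> sets N"
        from b show ?thesis
        proof (elim UnE CollectE exE conjE)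
          assume "b \<in> sets F"
          then show ?thesis using aDC by (intro genI[of _ "D \<inter> b" C]) auto
        next
          fix E B assume "b = E \<inter> G \<inter> Y -` B" "E \<in> sets F" "B \<in> sets N"
          then show ?thesis using aDC by (intro genI[of _ "D \<inter> E" "C \<inter> B"]) auto
        qed
      qed
    qed
  next
    fix E assume "E \<in> ?E2"
    moreover from this have "E \<in> sets F'"
      unfolding setsF'2 by auto
    moreover have "subalgebra ?D F'"
      using subQ by (simp add: subalgebra_def)
    ultimately show "emeasure (restr_to_subalg P F') E = emeasure (restr_to_subalg ?D F') E"
      using genF gen subP by (auto simp: emeasure_restr_to_subalg)
  next
    show "sets (restr_to_subalg P F') = sigma_sets (space P) ?E2"
      using subP setsF'2 by (simp add: sets_restr_to_subalg)
    show "sets (restr_to_subalg ?D F') = sigma_sets (space P) ?E2"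
      using subQ setsF'2 by (subst sets_restr_to_subalg) (auto simp: subalgebra_def)
    show "range (\<lambda>_. space P) \<subseteq> ?E2"
      using sets.top[of F] spF by auto
    show "emeasure (restr_to_subalg P F') (space P) \<noteq> \<infinity>"
      using subP spF' sets.top[of F'] by (simp add: emeasure_restr_to_subalg P.emeasure_space_1)
  qed (use E2_Pow in auto)
  show "emeasure P E = (\<integral>\<^sup>+\<omega>. L' \<omega> * indicator E \<omega> \<partial>Q)" if E: "E \<in> sets F'" for E
  proof -
    have "emeasure P E = emeasure (restr_to_subalg P F') E"
      using subP E by (simp add: emeasure_restr_to_subalg)
    also have "\<dots> = emeasure ?D E"
      unfolding eq using subQ E by (subst emeasure_restr_to_subalg) (auto simp: subalgebra_def)
    also have "\<dots> = (\<integral>\<^sup>+\<omega>. L' \<omega> * indicator E \<omega> \<partial>Q)"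
      using E F'P PQ L'Q by (subst emeasure_density) auto
    finally show ?thesis .
  qed
qed

section \<open>A weak law for predictably sampled sequences\<close>

text \<open>The sum is a martingale transform, so its increments are orthogonal: given \<open>F m\<close>, the weight
  \<open>\<xi> m\<close> and the earlier terms are known while \<open>W m\<close> is centred and independent.\<close>

lemma (in prob_space) predictable_sum_second_moment:
  fixes W \<xi> :: "nat \<Rightarrow> 'a \<Rightarrow> real" and F :: "nat \<Rightarrow> 'a measure"
  assumes F: "\<And>n. subalgebra M (F n)" and mono: "\<And>n. sets (F n) \<subseteq> sets (F (Suc n))"
    and W: "\<And>m. W m \<in> borel_measurable (F (Suc m))"
    and indep: "\<And>m u. u \<in> borel_measurable (F m) \<Longrightarrow> indep_var borel u borel (W m)"
    and bound: "\<And>m \<omega>. \<bar>W m \<omega>\<bar> \<le> c" and mean: "\<And>m. expectation (W m) = 0"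
    and \<xi>: "\<And>m. \<xi> m \<in> borel_measurable (F m)" "\<And>m \<omega>. \<bar>\<xi> m \<omega>\<bar> \<le> 1"
  shows "expectation (\<lambda>\<omega>. (\<Sum>m<N. \<xi> m \<omega> * W m \<omega>)\<^sup>2) \<le> real N * c\<^sup>2"
    and "integrable M (\<lambda>\<omega>. (\<Sum>m<N. \<xi> m \<omega> * W m \<omega>)\<^sup>2)"
proof -
  define D where "D N \<omega> = (\<Sum>m<N. \<xi> m \<omega> * W m \<omega>)" for N \<omega>
  have c: "0 \<le> c" using bound[of 0 undefined] by linarith
  have sub: "subalgebra (F (Suc n)) (F n)" for n
    using mono F by (auto simp: subalgebra_def)
  have D_F: "D N \<in> borel_measurable (F N)" for N
  proof (induction N)
    case (Suc N)
    have "D N \<in> borel_measurable (F (Suc N))" "\<xi> N \<in> borel_measurable (F (Suc N))"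
      using measurable_from_subalg[OF sub] Suc \<xi>(1) by blast+
    then show ?case
      using W[of N] by (simp add: D_def[abs_def])
  qed (simp add: D_def[abs_def])
  have D_bound: "\<bar>D N \<omega>\<bar> \<le> N * c" for N \<omega>
  proof -
    have "\<bar>D N \<omega>\<bar> \<le> (\<Sum>m<N. \<bar>\<xi> m \<omega> * W m \<omega>\<bar>)"
      unfolding D_def by (rule sum_abs)
    also have "\<dots> \<le> (\<Sum>m<N. c)"
      using \<xi>(2) bound by (intro sum_mono) (auto simp: abs_mult intro: mult_mono[of _ 1 _ c, simplified])
    finally show ?thesis by simp
  qed
  have M_F: "f \<in> borel_measurable M" if "f \<in> borel_measurable (F n)" for f :: "'a \<Rightarrow> real" and n
    using measurable_from_subalg[OF F that] .
  have [measurable]: "D N \<in> borel_measurable M" "\<xi> N \<in> borel_measurable M" "W N \<in> borel_measurable M" for N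
    using M_F D_F \<xi>(1) W by blast+
  have int_W: "integrable M (W m)" for m
    using bound by (intro integrable_const_bound[where B=c]) auto
  have int_D\<xi>: "integrable M (\<lambda>\<omega>. D N \<omega> * \<xi> N \<omega>)" for N
  proof (intro integrable_const_bound[where B="N * c"])
    show "AE x in M. norm (D N x * \<xi> N x) \<le> real N * c"
      using mult_mono[OF D_bound \<xi>(2), of N] c by (auto simp: abs_mult)
  qed auto
  have int_D2: "integrable M (\<lambda>\<omega>. (D N \<omega>)\<^sup>2)" for N
    using power_mono[OF D_bound[of N], where n=2] by (intro integrable_const_bound[where B="(N * c)\<^sup>2"]) auto
  have \<xi>W_bound: "(\<xi> N \<omega> * W N \<omega>)\<^sup>2 \<le> c\<^sup>2" for N \<omega>
  proof -
    have "\<bar>\<xi> N \<omega> * W N \<omega>\<bar> \<le> 1 * c"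
      unfolding abs_mult using \<xi>(2) bound by (intro mult_mono) auto
    then show ?thesis
      using c by (metis abs_le_square_iff abs_of_nonneg mult_1)
  qed
  have int_\<xi>W2: "integrable M (\<lambda>\<omega>. (\<xi> N \<omega> * W N \<omega>)\<^sup>2)" for N
    using \<xi>W_bound by (intro integrable_const_bound[where B="c\<^sup>2"]) auto
  have cross: "integrable M (\<lambda>\<omega>. (D N \<omega> * \<xi> N \<omega>) * W N \<omega>)"
    "expectation (\<lambda>\<omega>. (D N \<omega> * \<xi> N \<omega>) * W N \<omega>) = 0" for N
  proof -
    have "indep_var borel (\<lambda>\<omega>. D N \<omega> * \<xi> N \<omega>) borel (W N)"
      using D_F \<xi>(1) by (intro indep borel_measurable_times) auto
    then show "integrable M (\<lambda>\<omega>. (D N \<omega> * \<xi> N \<omega>) * W N \<omega>)"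
      "expectation (\<lambda>\<omega>. (D N \<omega> * \<xi> N \<omega>) * W N \<omega>) = 0"
      using indep_var_integrable[OF _ int_D\<xi> int_W] indep_var_lebesgue_integral[OF _ int_D\<xi> int_W] mean
      by auto
  qed
  have "expectation (\<lambda>\<omega>. (D N \<omega>)\<^sup>2) \<le> real N * c\<^sup>2"
  proof (induction N)
    case (Suc N)
    have "(\<lambda>\<omega>. (D (Suc N) \<omega>)\<^sup>2)
        = (\<lambda>\<omega>. (D N \<omega>)\<^sup>2 + 2 * ((D N \<omega> * \<xi> N \<omega>) * W N \<omega>) + (\<xi> N \<omega> * W N \<omega>)\<^sup>2)"
      by (auto simp: D_def power2_sum algebra_simps)
    then have "expectation (\<lambda>\<omega>. (D (Suc N) \<omega>)\<^sup>2)
        = expectation (\<lambda>\<omega>. (D N \<omega>)\<^sup>2) + expectation (\<lambda>\<omega>. (\<xi> N \<omega> * W N \<omega>)\<^sup>2)"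
      using int_D2 int_\<xi>W2 cross by simp
    also have "expectation (\<lambda>\<omega>. (\<xi> N \<omega> * W N \<omega>)\<^sup>2) \<le> c\<^sup>2"
      using \<xi>W_bound int_\<xi>W2 by (intro integral_le_const) auto
    finally show ?case
      using Suc by (simp add: algebra_simps)
  qed (simp add: D_def)
  then show "expectation (\<lambda>\<omega>. (\<Sum>m<N. \<xi> m \<omega> * W m \<omega>)\<^sup>2) \<le> real N * c\<^sup>2"
    and "integrable M (\<lambda>\<omega>. (\<Sum>m<N. \<xi> m \<omega> * W m \<omega>)\<^sup>2)"
    using int_D2[of N] by (simp_all add: D_def)
qed

lemma truncated_tail_tendsto_0:
  assumes "integrable D (\<lambda>x. x :: real)"
  shows "(\<lambda>b. \<integral>x. (if \<bar>x\<bar> \<le> real b then 0 else \<bar>x\<bar>) \<partial>D) \<longlonglongrightarrow> 0"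
proof -
  have [measurable]: "(\<lambda>x. x) \<in> borel_measurable D"
    using assms by (rule borel_measurable_integrable)
  have "(\<lambda>b. \<integral>x. (if \<bar>x\<bar> \<le> real b then 0 else \<bar>x\<bar>) \<partial>D) \<longlonglongrightarrow> (\<integral>x. 0 \<partial>D)"
  proof (rule integral_dominated_convergence[where w="\<lambda>x. \<bar>x\<bar>"])
    show "AE x in D. (\<lambda>b. if \<bar>x\<bar> \<le> real b then 0 else \<bar>x\<bar>) \<longlonglongrightarrow> 0"
    proof (rule AE_I2, rule tendsto_eventually)
      fix x :: real
      obtain n :: nat where "\<bar>x\<bar> \<le> real n" using real_arch_simple by blast
      then show "\<forall>\<^sub>F b in sequentially. (if \<bar>x\<bar> \<le> real b then 0 else \<bar>x\<bar>) = 0"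
        by (intro eventually_sequentiallyI[of n]) (auto intro: order_trans)
    qed
    show "integrable D (\<lambda>x. \<bar>x\<bar>)"
      using assms by (rule integrable_abs)
    show "AE x in D. norm (if \<bar>x\<bar> \<le> real b then 0 else \<bar>x\<bar>) \<le> \<bar>x\<bar>" for b
      by (rule AE_I2) simp
  qed measurable
  then show ?thesis by simp
qed

text \<open>A weak law that is uniform over all predictable weights.  Truncation at \<open>b\<close> splits the sum into a
  bounded martingale transform, handled by Chebyshev, and a remainder that is dominated, up to the
  shift of the mean, by the unweighted sum of the tails \<open>\<bar>Y m\<bar>\<close>, \<open>\<bar>Y m\<bar> > b\<close>, handled by Markov.  Neither bound depends
  on the weights, so \<open>N0\<close> can be chosen before \<open>\<xi>\<close>; this uniformity is what allows an infimum over
  policies later.  Stopping times are covered as well, because the indicator of not having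
  stopped is itself a predictable weight.\<close>

lemma (in prob_space) predictable_weak_law:
  fixes Y :: "nat \<Rightarrow> 'a \<Rightarrow> real" and F :: "nat \<Rightarrow> 'a measure" and D :: "real measure"
  assumes F: "\<And>n. subalgebra M (F n)" and mono: "\<And>n. sets (F n) \<subseteq> sets (F (Suc n))"
    and Y: "\<And>m. Y m \<in> borel_measurable (F (Suc m))"
    and indep: "\<And>m u. u \<in> borel_measurable (F m) \<Longrightarrow> indep_var borel u borel (Y m)"
    and D: "\<And>m. distr M borel (Y m) = D" and int: "integrable D (\<lambda>x. x)"
    and \<epsilon>: "0 < \<epsilon>" and \<delta>: "0 < (\<delta>::real)"
  shows "\<exists>N0. \<forall>N\<ge>N0. \<forall>\<xi>. (\<forall>m. \<xi> m \<in> borel_measurable (F m)) \<and> (\<forall>m \<omega>. \<bar>\<xi> m \<omega>\<bar> \<le> 1) \<longrightarrow>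
    prob {\<omega> \<in> space M. \<epsilon> * real N \<le> (\<Sum>m<N. \<xi> m \<omega> * (Y m \<omega> - (\<integral>x. x \<partial>D)))} \<le> \<delta>"
proof -
  let ?r = "\<lambda>b x. if \<bar>x\<bar> \<le> real b then 0 else \<bar>x :: real\<bar>"
  let ?t = "\<lambda>b x. if \<bar>x\<bar> \<le> real b then x else (0::real)"
  have "0 < min (\<epsilon> / 4) (\<epsilon> * \<delta> / 8)" using \<epsilon> \<delta> by auto
  from order_tendstoD(2)[OF truncated_tail_tendsto_0[OF int] this]
  obtain b where b: "(\<integral>x. ?r b x \<partial>D) < min (\<epsilon> / 4) (\<epsilon> * \<delta> / 8)"
    by (auto simp: eventually_sequentially)
  define \<tau> where "\<tau> = (\<integral>x. ?r b x \<partial>D)"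
  define \<mu> where "\<mu> = (\<integral>x. x \<partial>D)"
  define \<mu>' where "\<mu>' = (\<integral>x. ?t b x \<partial>D)"
  define W where "W m \<omega> = ?t b (Y m \<omega>) - \<mu>'" for m \<omega>
  have sD: "sets D = sets borel" using D[of 0] by auto
  have YM[measurable]: "Y m \<in> borel_measurable M" for m
    using measurable_from_subalg[OF F Y] .
  interpret D: prob_space D
    using prob_space_distr[OF YM[of 0]] D by simp
  have [measurable]: "?r b \<in> borel_measurable borel" "?t b \<in> borel_measurable borel"
    by measurable
  have int_r: "integrable D (?r b)" and int_t: "integrable D (?t b)"
    by (rule Bochner_Integration.integrable_bound[OF int]; use sD in \<open>simp cong: measurable_cong_sets\<close>)+
  have \<mu>\<mu>': "\<bar>\<mu> - \<mu>'\<bar> \<le> \<tau>"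
  proof -
    have "\<mu> - \<mu>' = (\<integral>x. x - ?t b x \<partial>D)"
      unfolding \<mu>_def \<mu>'_def using int int_t by simp
    also have "\<bar>\<dots>\<bar> \<le> (\<integral>x. \<bar>x - ?t b x\<bar> \<partial>D)"
      by (rule integral_abs_bound)
    also have "\<dots> = \<tau>"
      unfolding \<tau>_def by (intro Bochner_Integration.integral_cong) auto
    finally show ?thesis .
  qed
  have \<mu>'_b: "\<bar>\<mu>'\<bar> \<le> b"
  proof -
    have "\<bar>\<mu>'\<bar> \<le> (\<integral>x. \<bar>?t b x\<bar> \<partial>D)"
      unfolding \<mu>'_def by (rule integral_abs_bound)
    also have "\<dots> \<le> b"
      using int_t by (intro D.integral_le_const) auto
    finally show ?thesis .
  qed
  have EY: "expectation (\<lambda>\<omega>. f (Y m \<omega>)) = (\<integral>x. f x \<partial>D)" "integrable M (\<lambda>\<omega>. f (Y m \<omega>)) \<longleftrightarrow> integrable D f"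
    if "f \<in> borel_measurable borel" for f :: "real \<Rightarrow> real" and m
    using integral_distr[OF YM that, of m] integrable_distr_eq[OF YM that, of m] D[of m] by auto
  have W_mean: "expectation (W m) = 0" for m
    using EY[of "?t b" m] int_t unfolding W_def[abs_def] \<mu>'_def by (simp add: prob_space)
  have W_bound: "\<bar>W m \<omega>\<bar> \<le> 2 * b" for m \<omega>
    using \<mu>'_b by (auto simp: W_def)
  have W_indep: "indep_var borel u borel (W m)" if "u \<in> borel_measurable (F m)" for u m
  proof -
    have "indep_var borel (id \<circ> u) borel ((\<lambda>y. ?t b y - \<mu>') \<circ> Y m)"
      by (rule indep_var_compose[OF indep[OF that]]) auto
    then show ?thesis by (simp add: W_def[abs_def] comp_def)
  qed
  have W_F: "W m \<in> borel_measurable (F (Suc m))" for m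
    using Y[of m] unfolding W_def[abs_def] by measurable
  obtain N0 :: nat where N0: "32 * (real b)\<^sup>2 / (\<epsilon>\<^sup>2 * \<delta>) \<le> N0"
    using real_arch_simple by blast
  show ?thesis
  proof (intro exI[of _ "max 1 N0"] allI impI, elim conjE)
    fix N \<xi> assume N: "max 1 N0 \<le> N" and \<xi>: "\<forall>m. \<xi> m \<in> borel_measurable (F m)" "\<forall>m \<omega>. \<bar>\<xi> m \<omega>\<bar> \<le> (1::real)"
    have \<xi>M[measurable]: "\<xi> m \<in> borel_measurable M" for m
      using measurable_from_subalg[OF F] \<xi>(1) by blast
    have [measurable]: "W m \<in> borel_measurable M" for m
      using measurable_from_subalg[OF F W_F] .
    let ?A = "{\<omega> \<in> space M. (\<epsilon> * N / 2)\<^sup>2 \<le> (\<Sum>m<N. \<xi> m \<omega> * W m \<omega>)\<^sup>2}"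
    let ?B = "{\<omega> \<in> space M. \<epsilon> * N / 4 \<le> (\<Sum>m<N. ?r b (Y m \<omega>))}"
    have N1: "0 < real N" "real N0 \<le> real N" using N by auto
    have "prob ?A \<le> expectation (\<lambda>\<omega>. (\<Sum>m<N. \<xi> m \<omega> * W m \<omega>)\<^sup>2) / (\<epsilon> * N / 2)\<^sup>2"
      using predictable_sum_second_moment(2)[of F W "2 * b" \<xi>, OF F mono W_F W_indep W_bound W_mean] \<xi> N1 \<epsilon>
      by (intro integral_Markov_inequality_measure[where A="space M"]) auto
    also have "\<dots> \<le> (real N * (2 * b)\<^sup>2) / (\<epsilon> * N / 2)\<^sup>2"
      using predictable_sum_second_moment(1)[of F W "2 * b" \<xi>, OF F mono W_F W_indep W_bound W_mean] \<xi>
      by (intro divide_right_mono) auto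
    also have "\<dots> = (32 * (real b)\<^sup>2 / (\<epsilon>\<^sup>2 * \<delta>)) * (\<delta> / 2) / N"
      using N1 \<epsilon> \<delta> by (simp add: field_simps power2_eq_square)
    also have "\<dots> \<le> real N * (\<delta> / 2) / N"
      using N0 N1 \<delta> by (intro divide_right_mono mult_right_mono) auto
    also have "\<dots> = \<delta> / 2" using N1 by simp
    finally have A: "prob ?A \<le> \<delta> / 2" .
    have int_rY: "integrable M (\<lambda>\<omega>. ?r b (Y m \<omega>))" for m
      using EY(2)[of "?r b" m] int_r by simp
    have "prob ?B \<le> expectation (\<lambda>\<omega>. \<Sum>m<N. ?r b (Y m \<omega>)) / (\<epsilon> * N / 4)"
      using int_rY N1 \<epsilon>
      by (intro integral_Markov_inequality_measure[where A="space M"]) (auto intro!: sum_nonneg)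
    also have "expectation (\<lambda>\<omega>. \<Sum>m<N. ?r b (Y m \<omega>)) = N * \<tau>"
      using int_rY EY(1)[of "?r b"] by (simp add: \<tau>_def)
    also have "N * \<tau> / (\<epsilon> * N / 4) = 4 * \<tau> / \<epsilon>"
      using N1 by simp
    also have "\<dots> \<le> \<delta> / 2"
      using b \<epsilon> by (simp add: \<tau>_def field_simps)
    finally have B: "prob ?B \<le> \<delta> / 2" .
    have sub: "{\<omega> \<in> space M. \<epsilon> * real N \<le> (\<Sum>m<N. \<xi> m \<omega> * (Y m \<omega> - \<mu>))} \<subseteq> ?A \<union> ?B"
    proof
      fix \<omega> assume "\<omega> \<in> {\<omega> \<in> space M. \<epsilon> * real N \<le> (\<Sum>m<N. \<xi> m \<omega> * (Y m \<omega> - \<mu>))}"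
      then have \<omega>: "\<omega> \<in> space M" "\<epsilon> * real N \<le> (\<Sum>m<N. \<xi> m \<omega> * (Y m \<omega> - \<mu>))" by auto
      have "\<xi> m \<omega> * (Y m \<omega> - \<mu>) \<le> \<xi> m \<omega> * W m \<omega> + (?r b (Y m \<omega>) + \<tau>)" for m
      proof -
        have "\<xi> m \<omega> * (Y m \<omega> - \<mu> - W m \<omega>) \<le> \<bar>\<xi> m \<omega>\<bar> * \<bar>Y m \<omega> - \<mu> - W m \<omega>\<bar>"
          by (metis abs_ge_self abs_mult)
        also have "\<dots> \<le> 1 * (?r b (Y m \<omega>) + \<tau>)"
          using \<xi>(2) \<mu>\<mu>' by (intro mult_mono) (auto simp: W_def)
        finally show ?thesis by (simp add: algebra_simps)
      qed
      then have "(\<Sum>m<N. \<xi> m \<omega> * (Y m \<omega> - \<mu>)) \<le> (\<Sum>m<N. \<xi> m \<omega> * W m \<omega> + (?r b (Y m \<omega>) + \<tau>))"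
        by (intro sum_mono)
      also have "\<dots> = (\<Sum>m<N. \<xi> m \<omega> * W m \<omega>) + (\<Sum>m<N. ?r b (Y m \<omega>)) + N * \<tau>"
        by (simp add: sum.distrib)
      finally have "\<epsilon> * N \<le> (\<Sum>m<N. \<xi> m \<omega> * W m \<omega>) + (\<Sum>m<N. ?r b (Y m \<omega>)) + N * \<tau>"
        using \<omega>(2) by simp
      moreover have "N * \<tau> \<le> N * (\<epsilon> / 4)"
        using b by (intro mult_left_mono) (auto simp: \<tau>_def)
      ultimately have "\<epsilon> * N / 2 \<le> (\<Sum>m<N. \<xi> m \<omega> * W m \<omega>) \<or> \<epsilon> * N / 4 \<le> (\<Sum>m<N. ?r b (Y m \<omega>))"
        by (auto simp: field_simps)
      then show "\<omega> \<in> ?A \<union> ?B"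
        using \<omega>(1) \<epsilon> by (auto intro: power_mono)
    qed
    have "prob {\<omega> \<in> space M. \<epsilon> * real N \<le> (\<Sum>m<N. \<xi> m \<omega> * (Y m \<omega> - \<mu>))} \<le> prob (?A \<union> ?B)"
      by (rule finite_measure_mono[OF sub]) measurable
    also have "\<dots> \<le> prob ?A + prob ?B"
      by (rule measure_Un_le) measurable
    also have "\<dots> \<le> \<delta>" using A B by simp
    finally show "prob {\<omega> \<in> space M. \<epsilon> * real N \<le> (\<Sum>m<N. \<xi> m \<omega> * (Y m \<omega> - (\<integral>x. x \<partial>D)))} \<le> \<delta>"
      unfolding \<mu>_def .
  qed
qed

section \<open>Log-likelihood ratios of the sources\<close>

text \<open>A finite divergence excludes points where \<open>f\<close> is positive and \<open>g\<close> vanishes, since the extended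
  logarithm is \<open>\<infinity>\<close> there; off a null set the real-valued logarithm therefore agrees with the
  extended one.\<close>

lemma KL_info_finite:
  assumes f[measurable]: "f \<in> borel_measurable N" and f0: "\<And>x. x \<in> space N \<Longrightarrow> 0 \<le> f x"
    and g[measurable]: "g \<in> borel_measurable N" and g0: "\<And>x. x \<in> space N \<Longrightarrow> 0 \<le> g x"
    and KL: "0 < KL_info N f g" "KL_info N f g < \<infinity>"
  shows "AE x in N. 0 < f x \<longrightarrow> 0 < g x"
    and "integrable N (\<lambda>x. f x * ln (f x / g x))"
    and "(\<integral>x. f x * ln (f x / g x) \<partial>N) = real_of_ereal (KL_info N f g)"
proof -
  define h where "h x = llr f g x * ereal (f x)" for x
  let ?r = "\<lambda>x. f x * ln (f x / g x)"
  have h: "h x = (if f x = 0 then 0 else if g x = 0 then \<infinity> else ereal (?r x))"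
    if "x \<in> space N" for x
    using f0[OF that] g0[OF that]
    by (auto simp: h_def llr_def elog_def divide_ereal_def mult_le_0_iff divide_inverse mult.commute)
  have h_meas[measurable]: "h \<in> borel_measurable N"
    by (subst measurable_cong[OF h]) auto
  define p where "p = (\<integral>\<^sup>+x. e2ennreal (h x) \<partial>N)"
  define q where "q = (\<integral>\<^sup>+x. e2ennreal (- h x) \<partial>N)"
  have KL_eq: "KL_info N f g = enn2ereal p - enn2ereal q"
    by (simp add: KL_info_def eintegral_def p_def q_def h_def)
  have p_fin: "p \<noteq> \<infinity>"
    using KL unfolding KL_eq by (cases q) auto
  have q_fin: "q \<noteq> \<infinity>"
    using KL p_fin unfolding KL_eq by (cases p) auto
  have "AE x in N. e2ennreal (h x) \<noteq> \<infinity>"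
    using p_fin unfolding p_def by (intro nn_integral_PInf_AE) auto
  then show ac: "AE x in N. 0 < f x \<longrightarrow> 0 < g x"
  proof (rule AE_mp, intro AE_I2 impI)
    fix x assume x: "x \<in> space N" "e2ennreal (h x) \<noteq> \<infinity>" "0 < f x"
    then have "g x \<noteq> 0" by (auto simp: h)
    then show "0 < g x" using g0[OF x(1)] by simp
  qed
  have "AE x in N. h x = ereal (?r x)"
    using ac
  proof (rule AE_mp, intro AE_I2 impI)
    fix x assume x: "x \<in> space N" "0 < f x \<longrightarrow> 0 < g x"
    then show "h x = ereal (?r x)" using f0[OF x(1)] by (auto simp: h)
  qed
  then have p_eq: "p = (\<integral>\<^sup>+x. ennreal (?r x) \<partial>N)" and q_eq: "q = (\<integral>\<^sup>+x. ennreal (- ?r x) \<partial>N)"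
    unfolding p_def q_def by (auto intro!: nn_integral_cong_AE elim!: eventually_mono)
  show int: "integrable N ?r"
    using p_fin q_fin by (simp add: real_integrable_def p_eq q_eq)
  show "(\<integral>x. ?r x \<partial>N) = real_of_ereal (KL_info N f g)"
    using p_fin q_fin unfolding real_lebesgue_integral_def[OF int] KL_eq p_eq[symmetric] q_eq[symmetric]
    by (cases p; cases q) (auto simp: enn2real_def)
qed

lemma sort_map_eq: "sort (map f xs) = map f (sort_key f xs)"
  by (rule properties_for_sort) auto

context anomaly_model
begin

lemma space_P: "A \<subseteq> {1..M} \<Longrightarrow> space (P A) = space \<Omega>"
  using sets_P by (rule sets_eq_imp_space_eq)

lemma space_\<nu>: "i \<in> {1..M} \<Longrightarrow> space (\<nu> i) = space S"
  using sets_\<nu> by (rule sets_eq_imp_space_eq)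

text \<open>The density of source \<open>i\<close> when \<open>A\<close> is the anomalous set; as \<open>dens B i = dens (- A) i\<close> for
  \<open>i\<close> in the symmetric difference of \<open>A\<close> and \<open>B\<close>, the complement stands for the competing
  hypothesis about a single source.\<close>

definition dens :: "nat set \<Rightarrow> nat \<Rightarrow> 's \<Rightarrow> real" where
  "dens A i = (if i \<in> A then f1 i else f0 i)"

definition info :: "nat set \<Rightarrow> nat \<Rightarrow> real" where
  "info A i = (if i \<in> A then real_of_ereal (KL_info (\<nu> i) (f1 i) (f0 i))
                    else real_of_ereal (KL_info (\<nu> i) (f0 i) (f1 i)))"

definition log_lr :: "nat set \<Rightarrow> nat \<Rightarrow> 's \<Rightarrow> real" where
  "log_lr A i x = ln (dens A i x / dens (- A) i x)"

lemma dens_nonneg: "i \<in> {1..M} \<Longrightarrow> x \<in> space S \<Longrightarrow> 0 \<le> dens A i x"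
  using f0_nonneg f1_nonneg by (simp add: dens_def)

lemma dens_measurable: "i \<in> {1..M} \<Longrightarrow> dens A i \<in> borel_measurable S"
  using f0_measurable f1_measurable by (simp add: dens_def)

lemma log_lr_measurable: "i \<in> {1..M} \<Longrightarrow> log_lr A i \<in> borel_measurable S"
  using dens_measurable[of i A] dens_measurable[of i "- A"] unfolding log_lr_def[abs_def] by measurable

lemma distributed_X:
  "A \<subseteq> {1..M} \<Longrightarrow> i \<in> {1..M} \<Longrightarrow> 1 \<le> n \<Longrightarrow>
    distributed (P A) (\<nu> i) (X i n) (\<lambda>x. ennreal (dens A i x))"
  using X_anomalous[of A i n] X_normal[of A i n] by (auto simp: dens_def)

lemma X_measurable:
  assumes "i \<in> {1..M}" "1 \<le> n" shows "X i n \<in> \<Omega> \<rightarrow>\<^sub>M S"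
proof -
  have "X i n \<in> P {} \<rightarrow>\<^sub>M \<nu> i"
    using distributed_X[of "{}" i n] assms by (auto simp: distributed_def)
  then show ?thesis
    using sets_\<nu>[OF assms(1)] sets_P[of "{}"] by (simp cong: measurable_cong_sets)
qed

lemma P_measurable_eq: "A \<subseteq> {1..M} \<Longrightarrow> measurable (P A) N = measurable \<Omega> N"
  using sets_P by (intro measurable_cong_sets) auto

lemma dens_info:
  assumes "i \<in> {1..M}"
  shows "AE x in \<nu> i. 0 < dens A i x \<longrightarrow> 0 < dens (- A) i x"
    and "integrable (\<nu> i) (\<lambda>x. dens A i x * log_lr A i x)"
    and "(\<integral>x. dens A i x * log_lr A i x \<partial>\<nu> i) = info A i"
    and "0 < info A i"
proof -
  have KL: "0 < KL_info (\<nu> i) (dens A i) (dens (- A) i)" "KL_info (\<nu> i) (dens A i) (dens (- A) i) < \<infinity>"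
    using I_range J_range assms by (auto simp: dens_def)
  have info: "info A i = real_of_ereal (KL_info (\<nu> i) (dens A i) (dens (- A) i))"
    by (simp add: info_def dens_def)
  have d: "dens B i \<in> borel_measurable (\<nu> i)" "x \<in> space (\<nu> i) \<Longrightarrow> 0 \<le> dens B i x" for B x
    using dens_measurable[OF assms, of B] dens_nonneg[OF assms] space_\<nu>[OF assms] sets_\<nu>[OF assms]
    by (simp_all cong: measurable_cong_sets)
  note * = KL_info_finite[OF d d KL]
  show "AE x in \<nu> i. 0 < dens A i x \<longrightarrow> 0 < dens (- A) i x"
    and "integrable (\<nu> i) (\<lambda>x. dens A i x * log_lr A i x)"
    and "(\<integral>x. dens A i x * log_lr A i x \<partial>\<nu> i) = info A i"
    using * by (simp_all add: log_lr_def info)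
  show "0 < info A i"
    using KL unfolding info by (cases "KL_info (\<nu> i) (dens A i) (dens (- A) i)") auto
qed

lemma AE_dens_X:
  assumes "A \<subseteq> {1..M}" "i \<in> {1..M}" "1 \<le> n"
  shows "AE \<omega> in P A. 0 < dens A i (X i n \<omega>) \<and> 0 < dens (- A) i (X i n \<omega>)"
proof -
  have X: "X i n \<in> P A \<rightarrow>\<^sub>M \<nu> i" and d: "(\<lambda>x. ennreal (dens A i x)) \<in> borel_measurable (\<nu> i)"
    and eq: "distr (P A) (\<nu> i) (X i n) = density (\<nu> i) (\<lambda>x. ennreal (dens A i x))"
    using distributed_X[OF assms] by (auto simp: distributed_def)
  have "AE x in density (\<nu> i) (\<lambda>x. ennreal (dens A i x)). 0 < dens A i x \<and> 0 < dens (- A) i x"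
    unfolding AE_density[OF d] using dens_info(1)[OF assms(2), of A] by (auto elim!: eventually_mono)
  then show ?thesis
    unfolding eq[symmetric] by (rule AE_distrD[OF X])
qed

definition log_lr_law :: "nat set \<Rightarrow> nat \<Rightarrow> real measure" where
  "log_lr_law A i = distr (density (\<nu> i) (\<lambda>x. ennreal (dens A i x))) borel (log_lr A i)"

lemma log_lr_X_law:
  assumes A: "A \<subseteq> {1..M}" and i: "i \<in> {1..M}"
  shows "1 \<le> n \<Longrightarrow> distr (P A) borel (\<lambda>\<omega>. log_lr A i (X i n \<omega>)) = log_lr_law A i"
    and "integrable (log_lr_law A i) (\<lambda>x. x)"
    and "(\<integral>x. x \<partial>log_lr_law A i) = info A i"
proof -
  have l: "log_lr A i \<in> borel_measurable (\<nu> i)" and d: "dens A i \<in> borel_measurable (\<nu> i)"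
    using log_lr_measurable[OF i, of A] dens_measurable[OF i, of A] sets_\<nu>[OF i]
    by (simp_all cong: measurable_cong_sets)
  have nn: "AE x in \<nu> i. 0 \<le> dens A i x"
    using dens_nonneg[OF i] space_\<nu>[OF i] by (intro AE_I2) auto
  show "distr (P A) borel (\<lambda>\<omega>. log_lr A i (X i n \<omega>)) = log_lr_law A i" if "1 \<le> n"
    using distributed_X[OF A i that] l distr_distr[of "log_lr A i" "\<nu> i" borel "X i n" "P A"]
    by (simp add: distributed_def log_lr_law_def comp_def)
  show "integrable (log_lr_law A i) (\<lambda>x. x)"
    unfolding log_lr_law_def
    using dens_info(2)[OF i, of A] l d nn by (simp add: integrable_distr_eq integrable_real_density)
  show "(\<integral>x. x \<partial>log_lr_law A i) = info A i"
    unfolding log_lr_law_def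
    using dens_info(3)[OF i, of A] l d nn by (simp add: integral_distr integral_real_density)
qed

text \<open>The generators of the \<open>\<sigma>\<close>-algebras of the single variables: \<open>Inl (i, n)\<close> stands for \<open>X i n\<close> and
  \<open>Inr (i, n)\<close> for \<open>Z i n\<close>.\<close>

definition gen :: "(nat \<times> nat) + (nat \<times> nat) \<Rightarrow> 'w set set" where
  "gen = case_sum
     (\<lambda>(i, n). {X i n -` B \<inter> space \<Omega> | B. B \<in> sets S})
     (\<lambda>(i, n). {Z i n -` B \<inter> space \<Omega> | B. B \<in> sets borel})"

abbreviation Idx :: "((nat \<times> nat) + (nat \<times> nat)) set" where
  "Idx \<equiv> ({1..M} \<times> {1..}) <+> ({1..M} \<times> UNIV)"

lemma Int_stable_gen: "Int_stable (gen t)"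
proof -
  have *: "Int_stable {Y -` B \<inter> space \<Omega> | B. B \<in> sets N}" for Y :: "'w \<Rightarrow> 'c" and N
    unfolding Int_stable_def
  proof safe
    fix B C assume "B \<in> sets N" "C \<in> sets N"
    then show "\<exists>D. Y -` B \<inter> space \<Omega> \<inter> (Y -` C \<inter> space \<Omega>) = Y -` D \<inter> space \<Omega> \<and> D \<in> sets N"
      by (intro exI[of _ "B \<inter> C"]) auto
  qed
  show ?thesis
    unfolding gen_def by (auto split: sum.splits prod.splits intro!: *)
qed

lemma gen_Pow: "gen t \<subseteq> Pow (space \<Omega>)"
  unfolding gen_def by (auto split: sum.splits prod.splits)

lemma gen_events:
  assumes "t \<in> Idx" shows "gen t \<subseteq> sets \<Omega>"
proof -
  have "X i n -` B \<inter> space \<Omega> \<in> sets \<Omega>" if "i \<in> {1..M}" "1 \<le> n" "B \<in> sets S" for i n B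
    using measurable_sets[OF X_measurable[OF that(1,2)] that(3)] .
  moreover have "Z i n -` B \<inter> space \<Omega> \<in> sets \<Omega>" if "i \<in> {1..M}" "B \<in> sets borel" for i n B
    using measurable_sets[OF Z_measurable[OF that(1)] that(2)] .
  ultimately show ?thesis
    using assms by (fastforce simp: gen_def)
qed

lemma indep_gen:
  assumes A: "A \<subseteq> {1..M}" and J: "J \<subseteq> Idx" and t: "t \<in> Idx" "t \<notin> J"
  shows "prob_space.indep_set (P A) (sigma_sets (space \<Omega>) (\<Union>s\<in>J. gen s)) (gen t)"
proof -
  interpret P: prob_space "P A" by (rule prob_space_P[OF A])
  have "P.indep_sets gen Idx"
    unfolding gen_def by (rule independent[OF A])
  then have "P.indep_sets gen (\<Union>b\<in>UNIV. case_bool J {t} b)"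
    by (rule P.indep_sets_mono_index[rotated]) (use J t in \<open>auto split: bool.splits\<close>)
  then have "P.indep_sets (\<lambda>b. sigma_sets (space (P A)) (\<Union>s\<in>case_bool J {t} b. gen s)) UNIV"
    by (rule P.indep_sets_collect_sigma)
       (use t in \<open>auto simp: Int_stable_gen disjoint_family_on_def split: bool.splits\<close>)
  then show ?thesis
    unfolding P.indep_set_def space_P[OF A]
    by (rule P.indep_sets_mono_sets) (auto split: bool.splits)
qed

definition source_lr :: "nat set \<Rightarrow> nat set \<Rightarrow> nat \<Rightarrow> 's \<Rightarrow> ennreal" where
  "source_lr A B i x = (if i \<in> sym_diff A B then ennreal (dens A i x / dens (- A) i x) else 1)"

text \<open>The likelihood ratio of \<open>P A\<close> to \<open>P B\<close> given the first \<open>n\<close> rounds of sampling by \<open>R\<close>; the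
  randomization variables contribute the factor \<open>1\<close>.\<close>

definition lr :: "nat set \<Rightarrow> nat set \<Rightarrow> (nat \<Rightarrow> 'w \<Rightarrow> nat set) \<Rightarrow> nat \<Rightarrow> 'w \<Rightarrow> ennreal" where
  "lr A B R n \<omega> = (\<Prod>m=1..n. \<Prod>i=1..M. if i \<in> R m \<omega> then source_lr A B i (X i m \<omega>) else 1)"

definition past :: "nat \<Rightarrow> ((nat \<times> nat) + (nat \<times> nat)) set" where
  "past n = ({1..M} \<times> {1..n}) <+> ({1..M} \<times> {0..n})"

text \<open>\<open>L\<close> is the density of \<open>P A\<close> with respect to \<open>P B\<close> on \<open>H\<close>.  The index set \<open>J\<close> records which
  variables \<open>H\<close> depends on, so that every variable outside \<open>J\<close> is independent of \<open>H\<close>.\<close>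

definition lr_on :: "nat set \<Rightarrow> nat set \<Rightarrow> ((nat \<times> nat) + (nat \<times> nat)) set \<Rightarrow> 'w measure \<Rightarrow> ('w \<Rightarrow> ennreal) \<Rightarrow> bool" where
  "lr_on A B J H L \<longleftrightarrow> space H = space \<Omega> \<and> sets H \<subseteq> sigma_sets (space \<Omega>) (\<Union>t\<in>J. gen t) \<and>
     L \<in> borel_measurable H \<and>
     (\<forall>E\<in>sets H. emeasure (P A) E = (\<integral>\<^sup>+\<omega>. L \<omega> * indicator E \<omega> \<partial>P B))"

lemma lr_on_cong:
  assumes B: "B \<subseteq> {1..M}" and L: "lr_on A B J H L" and eq: "\<And>\<omega>. \<omega> \<in> space \<Omega> \<Longrightarrow> L \<omega> = L' \<omega>"
  shows "lr_on A B J H L'"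
proof -
  have "L' \<in> borel_measurable H \<longleftrightarrow> L \<in> borel_measurable H"
    using L eq by (intro measurable_cong) (auto simp: lr_on_def)
  moreover have "(\<integral>\<^sup>+\<omega>. L' \<omega> * indicator E \<omega> \<partial>P B) = (\<integral>\<^sup>+\<omega>. L \<omega> * indicator E \<omega> \<partial>P B)" for E
    using eq space_P[OF B] by (intro nn_integral_cong) auto
  ultimately show ?thesis
    using L by (simp add: lr_on_def)
qed

lemma lr_on_step:
  assumes A: "A \<subseteq> {1..M}" and B: "B \<subseteq> {1..M}" and lr: "lr_on A B J H L"
    and J: "J \<subseteq> Idx" and t: "t \<in> Idx" "t \<notin> J"
    and gen: "gen t = {Y -` C \<inter> space \<Omega> | C. C \<in> sets N}" and Y: "Y \<in> \<Omega> \<rightarrow>\<^sub>M N"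
    and l: "l \<in> borel_measurable N"
    and Pl: "\<And>C. C \<in> sets N \<Longrightarrow>
        emeasure (P A) (Y -` C \<inter> space \<Omega>) = (\<integral>\<^sup>+\<omega>. l (Y \<omega>) * indicator C (Y \<omega>) \<partial>P B)"
    and G: "{\<omega> \<in> space \<Omega>. G \<omega>} \<in> sets H"
  shows "\<exists>H'. lr_on A B (insert t J) H' (\<lambda>\<omega>. L \<omega> * (if G \<omega> then l (Y \<omega>) else 1)) \<and>
           sets H \<subseteq> sets H' \<and> (\<forall>C\<in>sets N. {\<omega> \<in> space \<Omega>. G \<omega> \<and> Y \<omega> \<in> C} \<in> sets H')"
proof -
  let ?G = "{\<omega> \<in> space \<Omega>. G \<omega>}"
  define H' where "H' = sigma (space \<Omega>) (sets H \<union> {?G \<inter> Y -` C | C. C \<in> sets N})"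
  have spP: "space (P A) = space \<Omega>" and spQ: "space (P B) = space \<Omega>"
    using A B by (auto simp: space_P)
  have spH: "space H = space \<Omega>" and HJ: "sets H \<subseteq> sigma_sets (space \<Omega>) (\<Union>t\<in>J. gen t)"
    and LH: "L \<in> borel_measurable H"
    and PL: "\<And>E. E \<in> sets H \<Longrightarrow> emeasure (P A) E = (\<integral>\<^sup>+\<omega>. L \<omega> * indicator E \<omega> \<partial>P B)"
    using lr by (auto simp: lr_on_def)
  have indep: "prob_space.indep_set (P D) (sets H) {Y -` C \<inter> space (P D) | C. C \<in> sets N}"
    if D: "D \<subseteq> {1..M}" for D
  proof -
    interpret D: prob_space "P D" by (rule prob_space_P[OF D])
    show ?thesis
      using indep_gen[OF D J t] HJ unfolding D.indep_set_def gen[symmetric] space_P[OF D]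
      by (elim D.indep_sets_mono_sets) (auto split: bool.splits)
  qed
  note step = change_of_measure_step[of "P A" "P B" H Y N L l ?G, unfolded spP, folded H'_def,
      OF prob_space_P[OF A] prob_space_P[OF B] _ spH _ indep[OF A, unfolded spP] indep[OF B] LH PL l Pl G]
  have PQ: "sets (P B) = sets (P A)" using sets_P A B by simp
  have YA: "Y \<in> P A \<rightarrow>\<^sub>M N" using Y by (simp add: P_measurable_eq[OF A])
  note step = step[OF PQ YA]
  have G_eq: "?G \<inter> Y -` C = {\<omega> \<in> space \<Omega>. G \<omega> \<and> Y \<omega> \<in> C}" for C by auto
  have spH': "space H' = space \<Omega>"
    unfolding H'_def by (simp add: space_measure_of_conv)
  have "sets H' \<subseteq> sigma_sets (space \<Omega>) (\<Union>t\<in>insert t J. gen t)" (is "_ \<subseteq> ?S")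
  proof -
    have Pow: "(\<Union>t\<in>insert t J. gen t) \<subseteq> Pow (space \<Omega>)"
      using gen_Pow by blast
    interpret S: sigma_algebra "space \<Omega>" ?S
      using Pow by (rule sigma_algebra_sigma_sets)
    have HS: "sets H \<subseteq> ?S"
      using HJ sigma_sets_mono'[of "\<Union>t\<in>J. gen t" "\<Union>t\<in>insert t J. gen t" "space \<Omega>"] by auto
    have "?G \<inter> Y -` C \<in> ?S" if C: "C \<in> sets N" for C
    proof -
      have "Y -` C \<inter> space \<Omega> \<in> gen t" unfolding gen using C by blast
      then have "Y -` C \<inter> space \<Omega> \<in> ?S" by (intro sigma_sets.Basic) auto
      moreover have "?G \<in> ?S" using G HS by auto
      ultimately have "?G \<inter> (Y -` C \<inter> space \<Omega>) \<in> ?S" by (rule S.Int[rotated])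
      also have "?G \<inter> (Y -` C \<inter> space \<Omega>) = ?G \<inter> Y -` C" by auto
      finally show ?thesis .
    qed
    then have "sets H \<union> {?G \<inter> Y -` C | C. C \<in> sets N} \<subseteq> ?S"
      using HS by auto
    then have "sigma_sets (space \<Omega>) (sets H \<union> {?G \<inter> Y -` C | C. C \<in> sets N}) \<subseteq> ?S"
      by (rule S.sigma_sets_subset)
    moreover have "sets H \<union> {?G \<inter> Y -` C | C. C \<in> sets N} \<subseteq> Pow (space \<Omega>)"
      using sets.space_closed[of H] spH by auto
    ultimately show ?thesis
      unfolding H'_def by (simp add: sets_measure_of)
  qed
  then have "lr_on A B (insert t J) H' (\<lambda>\<omega>. L \<omega> * (if \<omega> \<in> ?G then l (Y \<omega>) else 1))"
    using step(3,4) spH' unfolding lr_on_def by blast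
  then have "lr_on A B (insert t J) H' (\<lambda>\<omega>. L \<omega> * (if G \<omega> then l (Y \<omega>) else 1))"
    by (rule lr_on_cong[OF B]) auto
  then show ?thesis
    using step(1,2) unfolding G_eq by blast
qed

section \<open>The likelihood ratio on the observed filtration\<close>

text \<open>The randomization variables have the same law under all hypotheses, so observing them leaves the
  likelihood ratio unchanged.\<close>

lemma lr_on_observe_Z:
  assumes A: "A \<subseteq> {1..M}" and B: "B \<subseteq> {1..M}" and lr: "lr_on A B J H L"
    and J: "J \<subseteq> Idx" and i: "i \<in> {1..M}" and new: "Inr (i, n) \<notin> J"
  shows "\<exists>H'. lr_on A B (insert (Inr (i, n)) J) H' L \<and> sets H \<subseteq> sets H' \<and>
           (\<forall>C\<in>sets borel. Z i n -` C \<inter> space \<Omega> \<in> sets H')"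
proof -
  have gen: "gen (Inr (i, n)) = {Z i n -` C \<inter> space \<Omega> | C. C \<in> sets borel}"
    by (simp add: gen_def)
  have Pl: "emeasure (P A) (Z i n -` C \<inter> space \<Omega>) = (\<integral>\<^sup>+\<omega>. 1 * indicator C (Z i n \<omega>) \<partial>P B)"
    if C: "C \<in> sets borel" for C
  proof -
    have ZD: "Z i n \<in> P D \<rightarrow>\<^sub>M lborel" if "D \<subseteq> {1..M}" for D
      unfolding P_measurable_eq[OF that] using Z_measurable[OF i, of n] by (simp cong: measurable_cong_sets)
    have "emeasure (P A) (Z i n -` C \<inter> space \<Omega>) = emeasure (distr (P A) lborel (Z i n)) C"
      using C space_P[OF A] by (subst emeasure_distr[OF ZD[OF A]]) auto
    also have "\<dots> = emeasure (distr (P B) lborel (Z i n)) C"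
      using Z_uniform[OF A i] Z_uniform[OF B i] by simp
    also have "\<dots> = (\<integral>\<^sup>+x. indicator C x \<partial>distr (P B) lborel (Z i n))"
      using C by (subst nn_integral_indicator) auto
    also have "\<dots> = (\<integral>\<^sup>+\<omega>. indicator C (Z i n \<omega>) \<partial>P B)"
      using C by (intro nn_integral_distr[OF ZD[OF B]]) auto
    finally show ?thesis by simp
  qed
  have G: "{\<omega> \<in> space \<Omega>. True} \<in> sets H"
    using lr sets.top[of H] by (simp add: lr_on_def)
  have idx: "Inr (i, n) \<in> Idx" using i by auto
  obtain H' where H': "lr_on A B (insert (Inr (i, n)) J) H' (\<lambda>\<omega>. L \<omega> * (if True then 1 else 1))"
    "sets H \<subseteq> sets H'" "\<forall>C\<in>sets borel. {\<omega> \<in> space \<Omega>. True \<and> Z i n \<omega> \<in> C} \<in> sets H'"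
    using lr_on_step[OF A B lr J idx new gen Z_measurable[OF i] _ Pl G] by auto
  have "{\<omega> \<in> space \<Omega>. True \<and> Z i n \<omega> \<in> C} = Z i n -` C \<inter> space \<Omega>" for C by auto
  with H' show ?thesis by (intro exI[of _ H']) simp
qed

text \<open>The quotient of densities is a likelihood ratio because the finite divergence makes
  \<open>dens A i\<close> vanish almost everywhere where \<open>dens (- A) i\<close> does, so that nothing is lost by
  the convention \<open>x / 0 = 0\<close>.\<close>

lemma emeasure_X_source_lr:
  assumes A: "A \<subseteq> {1..M}" and B: "B \<subseteq> {1..M}" and i: "i \<in> {1..M}" and n: "1 \<le> n" and C: "C \<in> sets S"
  shows "emeasure (P A) (X i n -` C \<inter> space \<Omega>) =
    (\<integral>\<^sup>+\<omega>. source_lr A B i (X i n \<omega>) * indicator C (X i n \<omega>) \<partial>P B)"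
proof -
  have C\<nu>: "C \<in> sets (\<nu> i)" using C sets_\<nu>[OF i] by simp
  have meas: "dens D i \<in> borel_measurable (\<nu> i)" for D
    using dens_measurable[OF i, of D] sets_\<nu>[OF i] by (simp cong: measurable_cong_sets)
  have l: "source_lr A B i \<in> borel_measurable (\<nu> i)"
    using meas[of A] meas[of "- A"] unfolding source_lr_def[abs_def] by measurable
  have "emeasure (P A) (X i n -` C \<inter> space \<Omega>) = (\<integral>\<^sup>+x. ennreal (dens A i x) * indicator C x \<partial>\<nu> i)"
    using distributed_emeasure[OF distributed_X[OF A i n] C\<nu>] space_P[OF A] by simp
  also have "\<dots> = (\<integral>\<^sup>+x. ennreal (dens B i x) * (source_lr A B i x * indicator C x) \<partial>\<nu> i)"
  proof (rule nn_integral_cong_AE)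
    show "AE x in \<nu> i. ennreal (dens A i x) * indicator C x
        = ennreal (dens B i x) * (source_lr A B i x * indicator C x)"
      using dens_info(1)[OF i, of A] AE_space
    proof eventually_elim
      case (elim x)
      then have x: "x \<in> space S" using space_\<nu>[OF i] by simp
      have nn: "0 \<le> dens D i x" for D using dens_nonneg[OF i x] .
      show ?case
      proof (cases "i \<in> sym_diff A B")
        case False
        then have "dens B i x = dens A i x" by (auto simp: dens_def)
        then show ?thesis using False by (auto simp: source_lr_def)
      next
        case True
        then have "dens B i x = dens (- A) i x" by (auto simp: dens_def)
        moreover have "ennreal (dens A i x) = ennreal (dens (- A) i x) * ennreal (dens A i x / dens (- A) i x)"
        proof (cases "dens (- A) i x = 0")
          case True
          then have "dens A i x = 0" using elim(1) nn[of A] by (cases "0 < dens A i x") auto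
          then show ?thesis by simp
        next
          case False
          then show ?thesis
            using nn[of A] nn[of "- A"] by (simp add: ennreal_mult[symmetric])
        qed
        ultimately show ?thesis
          using True by (simp add: source_lr_def mult.assoc)
      qed
    qed
  qed
  also have "\<dots> = (\<integral>\<^sup>+\<omega>. source_lr A B i (X i n \<omega>) * indicator C (X i n \<omega>) \<partial>P B)"
    using l C\<nu> by (intro distributed_nn_integral[OF distributed_X[OF B i n], of "\<lambda>x. source_lr A B i x * indicator C x"]) auto
  finally show ?thesis .
qed

lemma source_lr_measurable: "i \<in> {1..M} \<Longrightarrow> source_lr A B i \<in> borel_measurable S"
  using dens_measurable[of i A] dens_measurable[of i "- A"] unfolding source_lr_def[abs_def] by measurable

lemma lr_on_observe_X:
  assumes A: "A \<subseteq> {1..M}" and B: "B \<subseteq> {1..M}" and lr: "lr_on A B J H L"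
    and J: "J \<subseteq> Idx" and i: "i \<in> {1..M}" and n: "1 \<le> n" and new: "Inl (i, n) \<notin> J"
    and G: "{\<omega> \<in> space \<Omega>. G \<omega>} \<in> sets H"
  shows "\<exists>H'. lr_on A B (insert (Inl (i, n)) J) H' (\<lambda>\<omega>. L \<omega> * (if G \<omega> then source_lr A B i (X i n \<omega>) else 1)) \<and>
           sets H \<subseteq> sets H' \<and> (\<forall>C\<in>sets S. {\<omega> \<in> space \<Omega>. G \<omega> \<and> X i n \<omega> \<in> C} \<in> sets H')"
proof (rule lr_on_step[OF A B lr J _ new _ X_measurable[OF i n] source_lr_measurable[OF i] _ G])
  show "Inl (i, n) \<in> Idx" using i n by auto
  show "gen (Inl (i, n)) = {X i n -` C \<inter> space \<Omega> | C. C \<in> sets S}" by (simp add: gen_def)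
qed (rule emeasure_X_source_lr[OF A B i n])

lemma lr_on_observe_all_Z:
  assumes A: "A \<subseteq> {1..M}" and B: "B \<subseteq> {1..M}" and lr: "lr_on A B J H L"
    and J: "J \<subseteq> Idx" and new: "\<And>i. Inr (i, n) \<notin> J" and r: "r \<le> M"
  shows "\<exists>H'. lr_on A B (J \<union> Inr ` ({1..r} \<times> {n})) H' L \<and> sets H \<subseteq> sets H' \<and>
           (\<forall>i\<in>{1..r}. \<forall>C\<in>sets borel. Z i n -` C \<inter> space \<Omega> \<in> sets H')"
  using r
proof (induction r)
  case 0
  then show ?case using lr by auto
next
  case (Suc r)
  then obtain H' where H': "lr_on A B (J \<union> Inr ` ({1..r} \<times> {n})) H' L" "sets H \<subseteq> sets H'"
    "\<forall>i\<in>{1..r}. \<forall>C\<in>sets borel. Z i n -` C \<inter> space \<Omega> \<in> sets H'" by auto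
  have r1: "Suc r \<in> {1..M}" using Suc.prems by auto
  have "\<exists>H''. lr_on A B (insert (Inr (Suc r, n)) (J \<union> Inr ` ({1..r} \<times> {n}))) H'' L \<and> sets H' \<subseteq> sets H'' \<and>
           (\<forall>C\<in>sets borel. Z (Suc r) n -` C \<inter> space \<Omega> \<in> sets H'')"
    using J new r1 by (intro lr_on_observe_Z[OF A B H'(1) _ r1]) auto
  moreover have "insert (Inr (Suc r, n)) (J \<union> Inr ` ({1..r} \<times> {n})) = J \<union> Inr ` ({1..Suc r} \<times> {n})"
    by (auto simp: atLeastAtMostSuc_conv)
  ultimately obtain H'' where H'': "lr_on A B (J \<union> Inr ` ({1..Suc r} \<times> {n})) H'' L" "sets H' \<subseteq> sets H''"
    "\<forall>C\<in>sets borel. Z (Suc r) n -` C \<inter> space \<Omega> \<in> sets H''" by auto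
  have "\<forall>i\<in>{1..Suc r}. \<forall>C\<in>sets borel. Z i n -` C \<inter> space \<Omega> \<in> sets H''"
    using H'(3) H''(2,3) by (auto simp: atLeastAtMostSuc_conv)
  then show ?case using H'(2) H''(1,2) by blast
qed

lemma lr_on_observe_all_X:
  assumes A: "A \<subseteq> {1..M}" and B: "B \<subseteq> {1..M}" and lr: "lr_on A B J H L"
    and J: "J \<subseteq> Idx" and n: "1 \<le> n" and new: "\<And>i. Inl (i, n) \<notin> J"
    and G: "\<And>i. i \<in> {1..M} \<Longrightarrow> {\<omega> \<in> space \<Omega>. i \<in> G \<omega>} \<in> sets H" and r: "r \<le> M"
  shows "\<exists>H'. lr_on A B (J \<union> Inl ` ({1..r} \<times> {n})) H'
             (\<lambda>\<omega>. L \<omega> * (\<Prod>i=1..r. if i \<in> G \<omega> then source_lr A B i (X i n \<omega>) else 1)) \<and> sets H \<subseteq> sets H' \<and>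
           (\<forall>i\<in>{1..r}. \<forall>C\<in>sets S. {\<omega> \<in> space \<Omega>. i \<in> G \<omega> \<and> X i n \<omega> \<in> C} \<in> sets H')"
  using r
proof (induction r)
  case 0
  then show ?case using lr by auto
next
  case (Suc r)
  let ?L = "\<lambda>r \<omega>. L \<omega> * (\<Prod>i=1..r. if i \<in> G \<omega> then source_lr A B i (X i n \<omega>) else 1)"
  obtain H' where H': "lr_on A B (J \<union> Inl ` ({1..r} \<times> {n})) H' (?L r)" "sets H \<subseteq> sets H'"
    "\<forall>i\<in>{1..r}. \<forall>C\<in>sets S. {\<omega> \<in> space \<Omega>. i \<in> G \<omega> \<and> X i n \<omega> \<in> C} \<in> sets H'"
    using Suc by auto
  have r1: "Suc r \<in> {1..M}" using Suc.prems by auto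
  have "\<exists>H''. lr_on A B (insert (Inl (Suc r, n)) (J \<union> Inl ` ({1..r} \<times> {n}))) H''
        (\<lambda>\<omega>. ?L r \<omega> * (if Suc r \<in> G \<omega> then source_lr A B (Suc r) (X (Suc r) n \<omega>) else 1)) \<and> sets H' \<subseteq> sets H'' \<and>
           (\<forall>C\<in>sets S. {\<omega> \<in> space \<Omega>. Suc r \<in> G \<omega> \<and> X (Suc r) n \<omega> \<in> C} \<in> sets H'')"
    using J new r1 n G[OF r1] H'(2) by (intro lr_on_observe_X[OF A B H'(1) _ r1 n]) auto
  moreover have "insert (Inl (Suc r, n)) (J \<union> Inl ` ({1..r} \<times> {n})) = J \<union> Inl ` ({1..Suc r} \<times> {n})"
    by (auto simp: atLeastAtMostSuc_conv)
  moreover have "(\<lambda>\<omega>. ?L r \<omega> * (if Suc r \<in> G \<omega> then source_lr A B (Suc r) (X (Suc r) n \<omega>) else 1)) = ?L (Suc r)"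
    by (simp add: mult.assoc)
  ultimately obtain H'' where H'': "lr_on A B (J \<union> Inl ` ({1..Suc r} \<times> {n})) H'' (?L (Suc r))" "sets H' \<subseteq> sets H''"
    "\<forall>C\<in>sets S. {\<omega> \<in> space \<Omega>. Suc r \<in> G \<omega> \<and> X (Suc r) n \<omega> \<in> C} \<in> sets H''" by auto
  have "\<forall>i\<in>{1..Suc r}. \<forall>C\<in>sets S. {\<omega> \<in> space \<Omega>. i \<in> G \<omega> \<and> X i n \<omega> \<in> C} \<in> sets H''"
    using H'(3) H''(2,3) by (auto simp: atLeastAtMostSuc_conv)
  then show ?case using H'(2) H''(1,2) by blast
qed

abbreviation obs :: "(nat \<Rightarrow> 'w \<Rightarrow> nat set) \<Rightarrow> nat \<Rightarrow> 'w measure" where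
  "obs \<equiv> obs_filtration M S \<Omega> X Z"

lemma sampling_rule_sets:
  assumes "sampling_rule M S \<Omega> X Z R"
  shows "{\<omega> \<in> space \<Omega>. i \<in> R (Suc n) \<omega>} \<in> sets (obs R n)"
    and "\<omega> \<in> space \<Omega> \<Longrightarrow> R (Suc n) \<omega> \<subseteq> {1..M}"
proof -
  have R: "R (Suc n) \<in> obs R n \<rightarrow>\<^sub>M count_space (Pow {1..M})"
    using assms unfolding sampling_rule_def by (metis Suc_eq_plus1 diff_Suc_1 le_add2)
  show sub: "\<omega> \<in> space \<Omega> \<Longrightarrow> R (Suc n) \<omega> \<subseteq> {1..M}" for \<omega>
    using measurable_space[OF R, of \<omega>] by simp
  have "R (Suc n) -` {r \<in> Pow {1..M}. i \<in> r} \<inter> space (obs R n) \<in> sets (obs R n)"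
    by (rule measurable_sets[OF R]) auto
  also have "R (Suc n) -` {r \<in> Pow {1..M}. i \<in> r} \<inter> space (obs R n) = {\<omega> \<in> space \<Omega>. i \<in> R (Suc n) \<omega>}"
    using sub by auto
  finally show "{\<omega> \<in> space \<Omega>. i \<in> R (Suc n) \<omega>} \<in> sets (obs R n)" .
qed

lemma past_sub_Idx: "past n \<subseteq> Idx"
  by (auto simp: past_def)

text \<open>The observed filtration is built from the single observations of each round.  Adding them one by one
  produces a \<open>\<sigma>\<close>-algebra \<open>H\<close> that contains every generator of \<open>obs R n\<close>.\<close>

lemma lr_on_obs:
  assumes A: "A \<subseteq> {1..M}" and B: "B \<subseteq> {1..M}" and R: "sampling_rule M S \<Omega> X Z R"
  shows "\<exists>H. sets (obs R n) \<subseteq> sets H \<and> lr_on A B (past n) H (lr A B R n)"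
proof (induction n)
  case 0
  interpret PA: prob_space "P A" by (rule prob_space_P[OF A])
  interpret PB: prob_space "P B" by (rule prob_space_P[OF B])
  have lr0: "lr_on A B {} (sigma (space \<Omega>) {}) (\<lambda>_. 1)"
    using PA.emeasure_space_1 PB.emeasure_space_1 space_P[OF A] space_P[OF B] sets.top[of "P B"]
    by (auto simp: lr_on_def space_measure_of_conv sigma_sets_empty_eq)
  obtain H' where H': "lr_on A B ({} \<union> Inr ` ({1..M} \<times> {0})) H' (\<lambda>_. 1)"
    "\<forall>i\<in>{1..M}. \<forall>C\<in>sets borel. Z i 0 -` C \<inter> space \<Omega> \<in> sets H'"
    using lr_on_observe_all_Z[OF A B lr0, where n=0 and r=M] by auto
  have "sets (obs R 0) \<subseteq> sets H'"
  proof -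
    have "{Z i 0 -` B \<inter> space \<Omega> | i B. i \<in> {1..M} \<and> B \<in> sets borel} \<subseteq> sets H'"
      using H'(2) by auto
    then have "sigma_sets (space \<Omega>) {Z i 0 -` B \<inter> space \<Omega> | i B. i \<in> {1..M} \<and> B \<in> sets borel} \<subseteq> sets H'"
      using sets.sigma_sets_subset[of _ H'] H'(1) by (simp add: lr_on_def)
    moreover have "{Z i 0 -` B \<inter> space \<Omega> | i B. i \<in> {1..M} \<and> B \<in> sets borel} \<subseteq> Pow (space \<Omega>)" by auto
    ultimately show ?thesis by (simp add: sets_measure_of)
  qed
  moreover have "{} \<union> Inr ` ({1..M} \<times> {0}) = past 0"
    by (auto simp: past_def)
  moreover have "lr A B R 0 = (\<lambda>_. 1)"
    by (simp add: lr_def[abs_def])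
  ultimately show ?case using H'(1) by auto
next
  case (Suc n)
  then obtain H where H: "sets (obs R n) \<subseteq> sets H" "lr_on A B (past n) H (lr A B R n)" by auto
  have newZ: "Inr (i, Suc n) \<notin> past n" for i by (auto simp: past_def)
  obtain H' where H': "lr_on A B (past n \<union> Inr ` ({1..M} \<times> {Suc n})) H' (lr A B R n)" "sets H \<subseteq> sets H'"
    "\<forall>i\<in>{1..M}. \<forall>C\<in>sets borel. Z i (Suc n) -` C \<inter> space \<Omega> \<in> sets H'"
    using lr_on_observe_all_Z[OF A B H(2) past_sub_Idx newZ order_refl] by blast
  let ?J = "past n \<union> Inr ` ({1..M} \<times> {Suc n})"
  have J: "?J \<subseteq> Idx" using past_sub_Idx[of n] by auto
  have G: "{\<omega> \<in> space \<Omega>. i \<in> R (Suc n) \<omega>} \<in> sets H'" for i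
    using sampling_rule_sets(1)[OF R] H(1) H'(2) by blast
  have new: "Inl (i, Suc n) \<notin> ?J" for i by (auto simp: past_def)
  obtain H'' where H'': "lr_on A B (?J \<union> Inl ` ({1..M} \<times> {Suc n})) H''
       (\<lambda>\<omega>. lr A B R n \<omega> * (\<Prod>i=1..M. if i \<in> R (Suc n) \<omega> then source_lr A B i (X i (Suc n) \<omega>) else 1))"
    "sets H' \<subseteq> sets H''"
    "\<forall>i\<in>{1..M}. \<forall>C\<in>sets S. {\<omega> \<in> space \<Omega>. i \<in> R (Suc n) \<omega> \<and> X i (Suc n) \<omega> \<in> C} \<in> sets H''"
    using lr_on_observe_all_X[OF A B H'(1) J _ new G, of M] by auto
  have "(\<lambda>\<omega>. lr A B R n \<omega> * (\<Prod>i=1..M. if i \<in> R (Suc n) \<omega> then source_lr A B i (X i (Suc n) \<omega>) else 1))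
      = lr A B R (Suc n)"
    by (simp add: lr_def[abs_def])
  moreover have "?J \<union> Inl ` ({1..M} \<times> {Suc n}) = past (Suc n)"
    by (auto simp: past_def atLeastAtMostSuc_conv atLeast0_atMost_Suc)
  moreover have "sets (obs R (Suc n)) \<subseteq> sets H''"
  proof -
    let ?E = "sets (obs R n)
        \<union> {Z i (Suc n) -` B \<inter> space \<Omega> | i B. i \<in> {1..M} \<and> B \<in> sets borel}
        \<union> {{\<omega> \<in> space \<Omega>. i \<in> R (Suc n) \<omega> \<and> X i (Suc n) \<omega> \<in> B} | i B. i \<in> {1..M} \<and> B \<in> sets S}"
    have "{Z i (Suc n) -` B \<inter> space \<Omega> | i B. i \<in> {1..M} \<and> B \<in> sets borel} \<subseteq> sets H''"
      using H'(3) H''(2) by blast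
    moreover have "{{\<omega> \<in> space \<Omega>. i \<in> R (Suc n) \<omega> \<and> X i (Suc n) \<omega> \<in> B} | i B. i \<in> {1..M} \<and> B \<in> sets S} \<subseteq> sets H''"
      using H''(3) by blast
    ultimately have "?E \<subseteq> sets H''"
      using H(1) H'(2) H''(2) by (intro Un_least) auto
    then have "sigma_sets (space \<Omega>) ?E \<subseteq> sets H''"
      using sets.sigma_sets_subset[of ?E H''] H''(1) by (simp add: lr_on_def)
    moreover have "?E \<subseteq> Pow (space \<Omega>)"
      using sets.space_closed[of "obs R n"] by auto
    ultimately show ?thesis by (simp add: sets_measure_of)
  qed
  ultimately show ?case using H''(1) by auto
qed

text \<open>All variables up to time \<open>n\<close>, sampled or not.  Unlike the observed filtration it does not depend
  on the policy.\<close>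

definition full_history :: "nat \<Rightarrow> 'w measure" where
  "full_history n = sigma (space \<Omega>) (\<Union>t\<in>past n. gen t)"

lemma space_full [simp]: "space (full_history n) = space \<Omega>"
  by (simp add: full_history_def space_measure_of_conv)

lemma sets_full: "sets (full_history n) = sigma_sets (space \<Omega>) (\<Union>t\<in>past n. gen t)"
  unfolding full_history_def using gen_Pow by (intro sets_measure_of) blast

lemma full_mono: "m \<le> n \<Longrightarrow> sets (full_history m) \<subseteq> sets (full_history n)"
  unfolding sets_full by (intro sigma_sets_mono' UN_mono) (auto simp: past_def)

lemma full_events: "sets (full_history n) \<subseteq> sets \<Omega>"
proof -
  have "(\<Union>t\<in>past n. gen t) \<subseteq> sets \<Omega>"
    using gen_events past_sub_Idx by blast
  then show ?thesis
    unfolding sets_full by (rule sets.sigma_sets_subset)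
qed

lemma subalgebra_full: "A \<subseteq> {1..M} \<Longrightarrow> subalgebra (P A) (full_history n)"
  using full_events sets_P space_P by (auto simp: subalgebra_def)

lemma obs_sub_full: "sampling_rule M S \<Omega> X Z R \<Longrightarrow> sets (obs R n) \<subseteq> sets (full_history n)"
  using lr_on_obs[of "{}" "{}" R n] by (auto simp: lr_on_def sets_full)

lemma change_of_measure_obs:
  assumes A: "A \<subseteq> {1..M}" and B: "B \<subseteq> {1..M}" and R: "sampling_rule M S \<Omega> X Z R"
    and E: "E \<in> sets (obs R n)"
  shows "{\<omega> \<in> E. lr A B R n \<omega> \<le> c} \<in> sets \<Omega>"
    and "emeasure (P A) {\<omega> \<in> E. lr A B R n \<omega> \<le> c} \<le> c * emeasure (P B) E"
proof -
  obtain H where H: "sets (obs R n) \<subseteq> sets H" and lr: "lr_on A B (past n) H (lr A B R n)"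
    using lr_on_obs[OF A B R] by blast
  let ?E = "{\<omega> \<in> E. lr A B R n \<omega> \<le> c}"
  have EH: "E \<in> sets H" using E H by auto
  have L: "lr A B R n \<in> borel_measurable H" and sp: "space H = space \<Omega>"
    using lr by (auto simp: lr_on_def)
  have "?E = {\<omega> \<in> space H. lr A B R n \<omega> \<le> c} \<inter> E"
    using sets.sets_into_space[OF EH] by auto
  moreover have "{\<omega> \<in> space H. lr A B R n \<omega> \<le> c} \<in> sets H"
    using L by measurable
  ultimately have E': "?E \<in> sets H" using EH by auto
  have H\<Omega>: "sets H \<subseteq> sets \<Omega>"
    using lr full_events[of n] by (auto simp: lr_on_def sets_full)
  then show "?E \<in> sets \<Omega>" using E' by auto
  have EB: "E \<in> sets (P B)" using EH H\<Omega> sets_P[OF B] by auto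
  have "emeasure (P A) ?E = (\<integral>\<^sup>+\<omega>. lr A B R n \<omega> * indicator ?E \<omega> \<partial>P B)"
    using lr E' by (auto simp: lr_on_def)
  also have "\<dots> \<le> (\<integral>\<^sup>+\<omega>. c * indicator E \<omega> \<partial>P B)"
    by (intro nn_integral_mono) (auto split: split_indicator)
  also have "\<dots> = c * emeasure (P B) E"
    using EB by (rule nn_integral_cmult_indicator)
  finally show "emeasure (P A) ?E \<le> c * emeasure (P B) E" .
qed

section \<open>Deviation of the sampled log-likelihood ratios\<close>

lemma X_measurable_full: 
  assumes i: "i \<in> {1..M}" shows "X i (Suc m) \<in> full_history (Suc m) \<rightarrow>\<^sub>M S"
proof (rule measurableI)
  have X: "X i (Suc m) \<in> \<Omega> \<rightarrow>\<^sub>M S" using X_measurable[OF i] by simp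
  show "X i (Suc m) \<omega> \<in> space S" if "\<omega> \<in> space (full_history (Suc m))" for \<omega>
    using measurable_space[OF X] that by simp
  fix C assume "C \<in> sets S"
  then have "X i (Suc m) -` C \<inter> space \<Omega> \<in> gen (Inl (i, Suc m))" by (auto simp: gen_def)
  moreover have "Inl (i, Suc m) \<in> past (Suc m)" using i by (auto simp: past_def)
  ultimately have "X i (Suc m) -` C \<inter> space \<Omega> \<in> sigma_sets (space \<Omega>) (\<Union>t\<in>past (Suc m). gen t)"
    by (intro sigma_sets.Basic) auto
  then show "X i (Suc m) -` C \<inter> space (full_history (Suc m)) \<in> sets (full_history (Suc m))"
    by (simp add: sets_full)
qed

lemma sampled_llr_deviation:
  assumes A: "A \<subseteq> {1..M}" and i: "i \<in> {1..M}" and \<eta>: "0 < \<eta>" and \<delta>: "0 < \<delta>"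
  shows "\<exists>N0. \<forall>N\<ge>N0. \<forall>\<xi>. (\<forall>m. \<xi> m \<in> borel_measurable (full_history m)) \<and> (\<forall>m \<omega>. \<bar>\<xi> m \<omega>\<bar> \<le> 1) \<longrightarrow>
    measure (P A) {\<omega> \<in> space \<Omega>. \<eta> * real N \<le>
      (\<Sum>m<N. \<xi> m \<omega> * (log_lr A i (X i (Suc m) \<omega>) - info A i))} \<le> \<delta>"
proof -
  interpret P: prob_space "P A" by (rule prob_space_P[OF A])
  have indep: "P.indep_var borel u borel (\<lambda>\<omega>. log_lr A i (X i (Suc m) \<omega>))"
    if u: "u \<in> borel_measurable (full_history m)" for u :: "'w \<Rightarrow> real" and m
  proof (rule P.indep_var_of_indep_set[OF _ _ _ u log_lr_measurable[OF i]])
    have "Inl (i, Suc m) \<in> Idx" "Inl (i, Suc m) \<notin> past m" using i by (auto simp: past_def)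
    from indep_gen[OF A past_sub_Idx this]
    show "P.indep_set (sets (full_history m)) {X i (Suc m) -` B \<inter> space (P A) | B. B \<in> sets S}"
      by (simp add: sets_full gen_def space_P[OF A])
    show "X i (Suc m) \<in> P A \<rightarrow>\<^sub>M S"
      using X_measurable[OF i, of "Suc m"] by (simp add: P_measurable_eq[OF A])
  qed (simp add: space_P[OF A])
  have Y: "(\<lambda>\<omega>. log_lr A i (X i (Suc m) \<omega>)) \<in> borel_measurable (full_history (Suc m))" for m
    using measurable_compose[OF X_measurable_full[OF i] log_lr_measurable[OF i]] .
  show ?thesis
    using P.predictable_weak_law[of full_history "\<lambda>m \<omega>. log_lr A i (X i (Suc m) \<omega>)", OF subalgebra_full[OF A]
        full_mono Y indep log_lr_X_law(1)[OF A i] log_lr_X_law(2)[OF A i] \<eta> \<delta>]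
    by (simp add: log_lr_X_law(3)[OF A i] space_P[OF A])
qed

text \<open>Almost surely under \<open>P A\<close> all observed densities are positive, so the product of quotients is the
  exponential of a sum of logarithms, now arranged by source.\<close>

lemma AE_lr_eq_exp:
  assumes A: "A \<subseteq> {1..M}" and R: "sampling_rule M S \<Omega> X Z R"
  shows "AE \<omega> in P A. \<forall>B n. B \<subseteq> {1..M} \<longrightarrow> lr A B R n \<omega> =
    ennreal (exp (\<Sum>i\<in>sym_diff A B. \<Sum>m=1..n. if i \<in> R m \<omega> then log_lr A i (X i m \<omega>) else 0))"
proof -
  have "AE \<omega> in P A. \<forall>i\<in>{1..M}. \<forall>m\<in>{1..}. 0 < dens A i (X i m \<omega>) \<and> 0 < dens (- A) i (X i m \<omega>)"
    using AE_dens_X[OF A] by (intro AE_ball_countable' ) auto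
  then show ?thesis
  proof (rule AE_mp, intro AE_I2 impI allI)
    fix \<omega> B n
    assume pos: "\<forall>i\<in>{1..M}. \<forall>m\<in>{1..}. 0 < dens A i (X i m \<omega>) \<and> 0 < dens (- A) i (X i m \<omega>)"
      and B: "B \<subseteq> {1..M}"
    let ?g = "\<lambda>i m. if i \<in> R m \<omega> then log_lr A i (X i m \<omega>) else 0"
    have "lr A B R n \<omega> = (\<Prod>m=1..n. \<Prod>i=1..M. ennreal (exp (if i \<in> sym_diff A B then ?g i m else 0)))"
      unfolding lr_def
      by (intro prod.cong refl) (use pos in \<open>auto simp: source_lr_def log_lr_def\<close>)
    also have "\<dots> = ennreal (exp (\<Sum>m=1..n. \<Sum>i=1..M. if i \<in> sym_diff A B then ?g i m else 0))"
      by (simp add: prod_ennreal prod_nonneg exp_sum)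
    also have "(\<Sum>m=1..n. \<Sum>i=1..M. if i \<in> sym_diff A B then ?g i m else 0)
        = (\<Sum>m=1..n. \<Sum>i\<in>sym_diff A B. ?g i m)"
    proof (rule sum.cong[OF refl])
      fix m
      have "{1..M} \<inter> sym_diff A B = sym_diff A B" using A B by auto
      then show "(\<Sum>i=1..M. if i \<in> sym_diff A B then ?g i m else 0) = (\<Sum>i\<in>sym_diff A B. ?g i m)"
        by (simp only: sum.inter_restrict[OF finite_atLeastAtMost, symmetric])
    qed
    also have "\<dots> = (\<Sum>i\<in>sym_diff A B. \<Sum>m=1..n. ?g i m)"
      by (rule sum.swap)
    finally show "lr A B R n \<omega> = ennreal (exp (\<Sum>i\<in>sym_diff A B. \<Sum>m=1..n. ?g i m))" .
  qed
qed

section \<open>The constant V along a sampling path\<close>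

lemma F_list_eq: "F_list M \<nu> f0 f1 A = map (info A) (sort_key (info A) [1..<M + 1])"
  unfolding F_list_def info_def[symmetric, abs_def] by (rule sort_map_eq)

lemma length_F_list: "length (F_list M \<nu> f0 f1 A) = M"
  by (simp add: F_list_eq)

text \<open>Sorting only renumbers the sources.\<close>

lemma F_list_enum:
  obtains \<sigma> where "bij_betw \<sigma> {1..M} {1..M}"
    and "\<And>j. j \<in> {1..M} \<Longrightarrow> F_list M \<nu> f0 f1 A ! (j - 1) = info A (\<sigma> j)"
proof
  let ?xs = "sort_key (info A) [1..<M + 1]"
  have "bij_betw ((!) ?xs) {..<M} {1..M}"
    by (rule bij_betw_nth) auto
  moreover have "bij_betw (\<lambda>j. j - 1) {1..M} {..<M}"
    by (rule bij_betwI[where g=Suc]) auto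
  ultimately show "bij_betw ((!) ?xs \<circ> (\<lambda>j. j - 1)) {1..M} {1..M}"
    by (rule bij_betw_trans[rotated])
  show "F_list M \<nu> f0 f1 A ! (j - 1) = info A (((!) ?xs \<circ> (\<lambda>j. j - 1)) j)" if "j \<in> {1..M}" for j
    unfolding F_list_eq using that by (subst nth_map) auto
qed

lemma min_weight_attained:
  assumes "k \<le> length L"
  obtains U where "U \<subseteq> {1..length L}" "card U = k" "min_weight k L c = (\<Sum>i\<in>U. c i * L ! (i - 1))"
proof -
  obtain U0 where "U0 \<subseteq> {1..length L}" "card U0 = k"
    using assms by (metis card_atLeastAtMost diff_Suc_1 obtain_subset_with_card_n)
  then have "{U. U \<subseteq> {1..length L} \<and> card U = k} \<noteq> {}" by auto
  then have "min_weight k L c \<in> (\<lambda>U. \<Sum>i\<in>U. c i * L ! (i - 1)) ` {U. U \<subseteq> {1..length L} \<and> card U = k}"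
    unfolding min_weight_def by (intro Min_in) auto
  then show ?thesis using that by auto
qed

lemma V_pos:
  assumes K: "0 < K" "K \<le> real M" and k: "k \<in> {1..M}"
  shows "0 < V M k K (F_list M \<nu> f0 f1 A)"
proof -
  let ?L = "F_list M \<nu> f0 f1 A"
  have kL: "k \<le> length ?L" "length ?L \<le> M" using k by (auto simp: length_F_list)
  have "(\<lambda>_. K / M) \<in> budget_vectors M K"
    using K by (auto simp: budget_vectors_def divide_le_eq)
  then have le: "min_weight k ?L (\<lambda>_. K / M) \<le> V M k K ?L"
    using V_is_max[OF K(1) kL] by auto
  obtain U where U: "U \<subseteq> {1..length ?L}" "card U = k"
    "min_weight k ?L (\<lambda>_. K / M) = (\<Sum>i\<in>U. K / M * ?L ! (i - 1))"
    using min_weight_attained[OF kL(1)] .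
  obtain \<sigma> where \<sigma>: "bij_betw \<sigma> {1..M} {1..M}" "\<And>j. j \<in> {1..M} \<Longrightarrow> ?L ! (j - 1) = info A (\<sigma> j)"
    using F_list_enum[of A] by blast
  have "0 < K / M * ?L ! (i - 1)" if "i \<in> U" for i
  proof -
    have i: "i \<in> {1..M}" using that U(1) length_F_list by auto
    then have "\<sigma> i \<in> {1..M}" using \<sigma>(1) by (auto simp: bij_betw_def)
    then show ?thesis using \<sigma>(2)[OF i] dens_info(4) K by auto
  qed
  moreover have "finite U" "U \<noteq> {}" using U k finite_subset by auto
  ultimately have "0 < min_weight k ?L (\<lambda>_. K / M)"
    unfolding U(3) by (intro sum_pos) auto
  then show ?thesis using le by simp
qed

text \<open>On a single path, the fractions of time spent on the sources form an element of the budget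
  polytope, so some \<open>k\<close> sources together have gathered at most \<open>n V\<close> units of information.\<close>

lemma path_information_bound:
  assumes K: "0 < K" and k: "k \<in> {1..M}"
    and r: "\<And>m. m \<in> {1..n} \<Longrightarrow> r m \<subseteq> {1..M}" and n: "1 \<le> n"
    and budget: "1 / real n * (\<Sum>m=1..n. real (card (r m))) \<le> K"
  obtains U where "U \<subseteq> {1..M}" "card U = k"
    "(\<Sum>i\<in>U. info A i * real (card {m\<in>{1..n}. i \<in> r m})) \<le> real n * V M k K (F_list M \<nu> f0 f1 A)"
proof -
  let ?L = "F_list M \<nu> f0 f1 A"
  have kL: "k \<le> length ?L" "length ?L \<le> M" using k by (auto simp: length_F_list)
  obtain \<sigma> where \<sigma>: "bij_betw \<sigma> {1..M} {1..M}" "\<And>j. j \<in> {1..M} \<Longrightarrow> ?L ! (j - 1) = info A (\<sigma> j)"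
    using F_list_enum[of A] by blast
  define N where "N i = real (card {m\<in>{1..n}. i \<in> r m})" for i
  have N: "0 \<le> N i" "N i \<le> n" for i
  proof -
    have "card {m\<in>{1..n}. i \<in> r m} \<le> card {1..n}" by (intro card_mono) auto
    then show "0 \<le> N i" "N i \<le> n" by (simp_all add: N_def)
  qed
  have "(\<Sum>i=1..M. N i) = (\<Sum>i=1..M. \<Sum>m=1..n. of_bool (i \<in> r m))"
    unfolding N_def by (simp add: of_bool_def sum.inter_filter[symmetric])
  also have "\<dots> = (\<Sum>m=1..n. \<Sum>i=1..M. of_bool (i \<in> r m))"
    by (rule sum.swap)
  also have "\<dots> = (\<Sum>m=1..n. real (card (r m)))"
  proof (rule sum.cong[OF refl])
    fix m assume "m \<in> {1..n}"
    then have "{1..M} \<inter> {i. i \<in> r m} = r m" using r by auto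
    then show "(\<Sum>i=1..M. of_bool (i \<in> r m)) = real (card (r m))"
      by (auto simp: sum.If_cases of_bool_def)
  qed
  finally have sum_N: "(\<Sum>i=1..M. N i) / n \<le> K"
    using budget by simp
  define c where "c j = N (\<sigma> j) / n" for j
  have "(\<Sum>j=1..M. c j) = (\<Sum>i=1..M. N i / n)"
    unfolding c_def by (rule sum.reindex_bij_betw[OF \<sigma>(1)])
  then have "c \<in> budget_vectors M K"
    using N n sum_N by (auto simp: budget_vectors_def c_def sum_divide_distrib)
  then have le: "min_weight k ?L c \<le> V M k K ?L"
    using V_is_max[OF K kL] by auto
  obtain U where U: "U \<subseteq> {1..length ?L}" "card U = k" "min_weight k ?L c = (\<Sum>i\<in>U. c i * ?L ! (i - 1))"
    using min_weight_attained[OF kL(1)] .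
  have UM: "U \<subseteq> {1..M}" using U(1) by (simp add: length_F_list)
  have inj: "inj_on \<sigma> U"
    using \<sigma>(1) UM by (meson bij_betw_def inj_on_subset)
  have "(\<Sum>i\<in>\<sigma> ` U. info A i * N i) = (\<Sum>j\<in>U. info A (\<sigma> j) * N (\<sigma> j))"
    by (simp add: sum.reindex[OF inj])
  also have "\<dots> = (\<Sum>j\<in>U. n * (c j * ?L ! (j - 1)))"
    using \<sigma>(2) UM n by (intro sum.cong refl) (auto simp: c_def)
  also have "\<dots> = n * min_weight k ?L c"
    unfolding U(3) by (simp add: sum_distrib_left)
  also have "\<dots> \<le> n * V M k K ?L"
    using le by (intro mult_left_mono) auto
  finally have "(\<Sum>i\<in>\<sigma> ` U. info A i * N i) \<le> n * V M k K ?L" .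
  moreover have "\<sigma> ` U \<subseteq> {1..M}" using \<sigma>(1) UM by (auto simp: bij_betw_def)
  moreover have "card (\<sigma> ` U) = k" using inj U(2) by (simp add: card_image)
  ultimately show ?thesis using that unfolding N_def by blast
qed

section \<open>Early stopping is unlikely\<close>

lemma stopped_decision_sets:
  assumes pol: "policy M S \<Omega> X Z R T \<Delta>"
  shows "{\<omega> \<in> space \<Omega>. T \<omega> \<le> enat n} \<in> sets (obs R n)"
    and "{\<omega> \<in> space \<Omega>. \<Delta> \<omega> = D \<and> T \<omega> = enat n} \<in> sets (obs R n)"
    and "\<Delta> \<in> \<Omega> \<rightarrow>\<^sub>M count_space (Pow {1..M})"
proof -
  let ?F = "obs_filtration_enat M S \<Omega> X Z R"
  have R: "sampling_rule M S \<Omega> X Z R" and T: "stopping_time ?F T"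
    and \<Delta>: "\<Delta> \<in> filtration.pre_sigma (space \<Omega>) ?F T \<rightarrow>\<^sub>M count_space (Pow {1..M})"
    using pol by (auto simp: policy_def)
  interpret filtration "space \<Omega>" ?F by (rule filtration_obs_filtration_enat)
  have F: "?F (enat n) = obs R n" for n by (simp add: obs_filtration_enat_def)
  have obs_mono: "sets (obs R m) \<subseteq> sets (obs R n)" if "m \<le> n" for m n
    using sets_F_mono[of "enat m" "enat n"] that by (simp add: F)
  have T_le: "{\<omega> \<in> space \<Omega>. T \<omega> \<le> enat n} \<in> sets (obs R n)" for n
    using stopping_timeD[OF T, of "enat n"] by (simp add: F pred_def)
  show "{\<omega> \<in> space \<Omega>. T \<omega> \<le> enat n} \<in> sets (obs R n)" by (rule T_le)
  have T_less: "{\<omega> \<in> space \<Omega>. T \<omega> < enat n} \<in> sets (obs R n)" for n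
  proof (cases n)
    case 0
    then show ?thesis by (simp add: zero_enat_def[symmetric])
  next
    case (Suc m)
    have "{\<omega> \<in> space \<Omega>. T \<omega> < enat n} = {\<omega> \<in> space \<Omega>. T \<omega> \<le> enat m}"
      unfolding Suc by (metis (no_types, opaque_lifting) Suc_ile_eq not_le)
    then show ?thesis using T_le[of m] obs_mono[of m n] Suc by auto
  qed
  have D_pre: "{\<omega> \<in> space \<Omega>. \<Delta> \<omega> = D} \<in> sets (pre_sigma T)" for D
  proof -
    have "\<Delta> -` ({D} \<inter> Pow {1..M}) \<inter> space (pre_sigma T) \<in> sets (pre_sigma T)"
      by (rule measurable_sets[OF \<Delta>]) auto
    also have "\<Delta> -` ({D} \<inter> Pow {1..M}) \<inter> space (pre_sigma T) = {\<omega> \<in> space \<Omega>. \<Delta> \<omega> = D}"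
      using measurable_space[OF \<Delta>] by (auto simp: space_pre_sigma)
    finally show ?thesis .
  qed
  have "{\<omega> \<in> {\<omega> \<in> space \<Omega>. \<Delta> \<omega> = D}. T \<omega> \<le> enat n} \<in> sets (obs R n)"
    using sets_pre_sigmaD[OF T D_pre, of _ "enat n"] by (simp add: F)
  then have "{\<omega> \<in> {\<omega> \<in> space \<Omega>. \<Delta> \<omega> = D}. T \<omega> \<le> enat n} - {\<omega> \<in> space \<Omega>. T \<omega> < enat n} \<in> sets (obs R n)"
    using T_less by auto
  also have "{\<omega> \<in> {\<omega> \<in> space \<Omega>. \<Delta> \<omega> = D}. T \<omega> \<le> enat n} - {\<omega> \<in> space \<Omega>. T \<omega> < enat n}
      = {\<omega> \<in> space \<Omega>. \<Delta> \<omega> = D \<and> T \<omega> = enat n}"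
    by auto
  finally show "{\<omega> \<in> space \<Omega>. \<Delta> \<omega> = D \<and> T \<omega> = enat n} \<in> sets (obs R n)" .
  have "sets (?F \<infinity>) \<subseteq> sets \<Omega>"
  proof -
    have *: "(\<Union>n. sets (obs R n)) \<subseteq> sets \<Omega>"
      using obs_sub_full[OF R] full_events by blast
    have "(\<Union>n. sets (obs R n)) \<subseteq> Pow (space \<Omega>)"
      using * sets.space_closed[of \<Omega>] by blast
    then show ?thesis
      using sets.sigma_sets_subset[OF *] by (simp add: obs_filtration_enat_def sets_measure_of)
  qed
  moreover have "E \<in> sets (?F \<infinity>)" if "E \<in> sets (pre_sigma T)" for E
    using sets_pre_sigmaD[OF T that, of \<infinity>] by simp
  ultimately have "subalgebra \<Omega> (pre_sigma T)"
    by (auto simp: subalgebra_def space_pre_sigma)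
  then show "\<Delta> \<in> \<Omega> \<rightarrow>\<^sub>M count_space (Pow {1..M})"
    using \<Delta> by (rule measurable_from_subalg)
qed

text \<open>If the decision \<open>d\<close> is an error under \<open>B\<close>, it can be taken with likelihood ratio at most
  \<open>exp lam\<close> only with small probability under \<open>P A\<close>.  The statement is pathwise in the likelihood ratio
  and so is not affected by \<open>P A\<close> spreading its mass over several correct decisions.\<close>

lemma wrong_decision_bound:
  fixes N :: nat and lam :: real
  assumes A: "A \<subseteq> {1..M}" and B: "B \<subseteq> {1..M}" and \<alpha>: "0 \<le> \<alpha>"
    and adm: "(R, T, \<Delta>) \<in> admissible_policies M S \<Omega> P X Z \<alpha> k K"
    and wrong: "k \<le> card (sym_diff B d)"
  defines "W \<equiv> \<Union>n\<in>{..N}. {\<omega> \<in> {\<omega> \<in> space \<Omega>. \<Delta> \<omega> = d \<and> T \<omega> = enat n}.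
      lr A B R n \<omega> \<le> ennreal (exp lam)}"
  shows "W \<in> sets \<Omega>" and "measure (P A) W \<le> exp lam * \<alpha>"
proof -
  have pol: "policy M S \<Omega> X Z R T \<Delta>"
    and err: "\<And>B. B \<subseteq> {1..M} \<Longrightarrow> measure (P B) {\<omega> \<in> space \<Omega>. k \<le> card (sym_diff B (\<Delta> \<omega>))} \<le> \<alpha>"
    using adm by (auto simp: admissible_policies_def budget_policies_def)
  have R: "sampling_rule M S \<Omega> X Z R" using pol by (simp add: policy_def)
  interpret PA: prob_space "P A" by (rule prob_space_P[OF A])
  interpret PB: prob_space "P B" by (rule prob_space_P[OF B])
  let ?E = "\<lambda>n. {\<omega> \<in> space \<Omega>. \<Delta> \<omega> = d \<and> T \<omega> = enat n}"
  let ?W = "\<lambda>n. {\<omega> \<in> ?E n. lr A B R n \<omega> \<le> ennreal (exp lam)}"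
  have E: "?E n \<in> sets (obs R n)" for n by (rule stopped_decision_sets(2)[OF pol])
  have E\<Omega>: "?E n \<in> sets \<Omega>" for n
    using E[of n] obs_sub_full[OF R, of n] full_events[of n] by auto
  note W = change_of_measure_obs[OF A B R E, of _ "ennreal (exp lam)"]
  show W\<Omega>: "W \<in> sets \<Omega>"
    unfolding W_def using W(1) by (intro sets.finite_UN) auto
  have "emeasure (P A) W \<le> (\<Sum>n\<le>N. emeasure (P A) (?W n))"
    unfolding W_def using W(1) sets_P[OF A] by (intro emeasure_subadditive_finite) auto
  also have "\<dots> \<le> (\<Sum>n\<le>N. ennreal (exp lam) * emeasure (P B) (?E n))"
    using W(2) by (intro sum_mono)
  also have "\<dots> = ennreal (exp lam) * emeasure (P B) (\<Union>n\<in>{..N}. ?E n)"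
    unfolding sum_distrib_left[symmetric] using E\<Omega> sets_P[OF B]
    by (subst sum_emeasure) (auto simp: disjoint_family_on_def)
  also have "\<dots> \<le> ennreal (exp lam) * emeasure (P B) {\<omega> \<in> space \<Omega>. k \<le> card (sym_diff B (\<Delta> \<omega>))}"
  proof (intro mult_left_mono emeasure_mono)
    show "(\<Union>n\<in>{..N}. ?E n) \<subseteq> {\<omega> \<in> space \<Omega>. k \<le> card (sym_diff B (\<Delta> \<omega>))}"
      using wrong by auto
    have "\<Delta> -` {d \<in> Pow {1..M}. k \<le> card (sym_diff B d)} \<inter> space \<Omega> \<in> sets \<Omega>"
      by (rule measurable_sets[OF stopped_decision_sets(3)[OF pol]]) auto
    also have "\<Delta> -` {d \<in> Pow {1..M}. k \<le> card (sym_diff B d)} \<inter> space \<Omega>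
        = {\<omega> \<in> space \<Omega>. k \<le> card (sym_diff B (\<Delta> \<omega>))}"
      using measurable_space[OF stopped_decision_sets(3)[OF pol]] by auto
    finally show "{\<omega> \<in> space \<Omega>. k \<le> card (sym_diff B (\<Delta> \<omega>))} \<in> sets (P B)"
      using sets_P[OF B] by simp
  qed simp
  also have "\<dots> \<le> ennreal (exp lam) * ennreal \<alpha>"
    using err[OF B] by (intro mult_left_mono) (auto simp: PB.emeasure_eq_measure intro: ennreal_leI)
  also have "\<dots> = ennreal (exp lam * \<alpha>)"
    using \<alpha> by (simp add: ennreal_mult)
  finally show "measure (P A) W \<le> exp lam * \<alpha>"
    using \<alpha> by (simp add: PA.emeasure_eq_measure)
qed

text \<open>A decision that differs from \<open>A\<close> by \<open>D\<close> is compared with the alternative that flips only \<open>U - D\<close>: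
  the two then differ by all of \<open>U \<union> D\<close>.  Flipping \<open>U\<close> itself would not do, since \<open>D\<close> and \<open>U\<close> may
  overlap and then the decision could be acceptable under both hypotheses.\<close>

lemma card_sym_diff_completed:
  assumes "finite D" and "finite U"
  shows "card U \<le> card (sym_diff (sym_diff A (U - D)) (sym_diff A D))"
proof -
  have "sym_diff (sym_diff A (U - D)) (sym_diff A D) = U \<union> D" by auto
  then show ?thesis using assms by (simp add: card_mono)
qed

text \<open>Outside an erroneous decision, an unlikely small likelihood ratio, and a large deviation, a path
  that stops at \<open>n \<le> N\<close> is contradictory: the decision is off by some \<open>D\<close> with fewer than \<open>k\<close> elements,
  so for every \<open>U\<close> of size \<open>k\<close> the sources in \<open>U - D\<close> must have collected evidence above \<open>lam\<close>, whereas
  for one such \<open>U\<close> the information is at most \<open>n V\<close>.\<close>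

lemma early_stopping_bound:
  assumes A: "A \<subseteq> {1..M}" and adm: "(R, T, \<Delta>) \<in> admissible_policies M S \<Omega> P X Z \<alpha> k K"
    and K: "0 < K" and k: "k \<in> {1..M}" and \<alpha>: "0 \<le> \<alpha>" and lam: "0 < lam" and \<eta>: "0 < \<eta>"
    and N: "real N * V M k K (F_list M \<nu> f0 f1 A) + real M * (\<eta> * real N) \<le> lam"
    and dev: "\<And>i \<xi>. i \<in> {1..M} \<Longrightarrow> (\<And>m. \<xi> m \<in> borel_measurable (full_history m)) \<Longrightarrow> (\<And>m \<omega>. \<bar>\<xi> m \<omega>\<bar> \<le> 1) \<Longrightarrow>
      measure (P A) {\<omega> \<in> space \<Omega>. \<eta> * real N \<le>
        (\<Sum>m<N. \<xi> m \<omega> * (log_lr A i (X i (Suc m) \<omega>) - info A i))} \<le> \<delta>"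
  shows "{\<omega> \<in> space \<Omega>. T \<omega> \<le> enat N} \<in> sets \<Omega>"
    and "measure (P A) {\<omega> \<in> space \<Omega>. T \<omega> \<le> enat N} \<le> \<alpha> + 2 ^ M * 2 ^ M * (exp lam * \<alpha>) + real M * \<delta>"
proof -
  let ?V = "V M k K (F_list M \<nu> f0 f1 A)"
  have pol: "policy M S \<Omega> X Z R T \<Delta>"
    and err: "measure (P A) {\<omega> \<in> space \<Omega>. k \<le> card (sym_diff A (\<Delta> \<omega>))} \<le> \<alpha>"
    and budget: "AE \<omega> in P A. \<forall>n\<ge>1. T \<omega> = enat n \<longrightarrow>
            1 / real n * (\<Sum>m = 1..n. real (card (R m \<omega>))) \<le> K"
    using adm A by (auto simp: admissible_policies_def budget_policies_def)
  have R: "sampling_rule M S \<Omega> X Z R" using pol by (simp add: policy_def)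
  interpret PA: prob_space "P A" by (rule prob_space_P[OF A])
  have \<Delta>: "\<Delta> \<in> \<Omega> \<rightarrow>\<^sub>M count_space (Pow {1..M})" by (rule stopped_decision_sets(3)[OF pol])
  have obs_full: "E \<in> sets (obs R n) \<Longrightarrow> E \<in> sets (full_history n)" for E n
    using obs_sub_full[OF R, of n] by auto
  have T_full: "{\<omega> \<in> space \<Omega>. T \<omega> \<le> enat n} \<in> sets (full_history n)" for n
    using stopped_decision_sets(1)[OF pol] by (rule obs_full)
  then show T\<Omega>: "{\<omega> \<in> space \<Omega>. T \<omega> \<le> enat N} \<in> sets \<Omega>"
    using full_events by blast
  define \<xi> where "\<xi> i m = (indicator {\<omega> \<in> space \<Omega>. \<not> T \<omega> \<le> enat m \<and> i \<in> R (Suc m) \<omega>} :: 'w \<Rightarrow> real)" for i m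
  have \<xi>_meas: "\<xi> i m \<in> borel_measurable (full_history m)" for i m
  proof -
    have "{\<omega> \<in> space \<Omega>. i \<in> R (Suc m) \<omega>} - {\<omega> \<in> space \<Omega>. T \<omega> \<le> enat m} \<in> sets (full_history m)"
      using T_full obs_full[OF sampling_rule_sets(1)[OF R]] by auto
    also have "{\<omega> \<in> space \<Omega>. i \<in> R (Suc m) \<omega>} - {\<omega> \<in> space \<Omega>. T \<omega> \<le> enat m}
        = {\<omega> \<in> space \<Omega>. \<not> T \<omega> \<le> enat m \<and> i \<in> R (Suc m) \<omega>}" by auto
    finally show ?thesis unfolding \<xi>_def by (rule borel_measurable_indicator)
  qed
  have \<xi>_le: "\<bar>\<xi> i m \<omega>\<bar> \<le> 1" for i m \<omega> by (simp add: \<xi>_def indicator_def)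
  define err_ev where "err_ev = {\<omega> \<in> space \<Omega>. k \<le> card (sym_diff A (\<Delta> \<omega>))}"
  define W where "W = (\<lambda>(D, U). \<Union>n\<in>{..N}. {\<omega> \<in> {\<omega> \<in> space \<Omega>. \<Delta> \<omega> = sym_diff A D \<and> T \<omega> = enat n}.
      lr A (sym_diff A (U - D)) R n \<omega> \<le> ennreal (exp lam)})"
  define I where "I = Pow {1..M} \<times> {U. U \<subseteq> {1..M} \<and> card U = k}"
  define dev_ev where "dev_ev i = {\<omega> \<in> space \<Omega>. \<eta> * real N \<le>
        (\<Sum>m<N. \<xi> i m \<omega> * (log_lr A i (X i (Suc m) \<omega>) - info A i))}" for i
  have err_\<Omega>: "err_ev \<in> sets \<Omega>"
  proof -
    have "\<Delta> -` {d \<in> Pow {1..M}. k \<le> card (sym_diff A d)} \<inter> space \<Omega> \<in> sets \<Omega>"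
      by (rule measurable_sets[OF \<Delta>]) auto
    also have "\<Delta> -` {d \<in> Pow {1..M}. k \<le> card (sym_diff A d)} \<inter> space \<Omega> = err_ev"
      using measurable_space[OF \<Delta>] by (auto simp: err_ev_def)
    finally show ?thesis .
  qed
  have W_bound: "W p \<in> sets \<Omega>" "measure (P A) (W p) \<le> exp lam * \<alpha>" if "p \<in> I" for p
  proof -
    obtain D U where p: "p = (D, U)" "D \<subseteq> {1..M}" "U \<subseteq> {1..M}" "card U = k"
      using \<open>p \<in> I\<close> by (auto simp: I_def)
    have fin: "finite D" "finite U" using p finite_subset[OF _ finite_atLeastAtMost] by auto
    have B: "sym_diff A (U - D) \<subseteq> {1..M}" using A p by auto
    note * = wrong_decision_bound[OF A B \<alpha> adm card_sym_diff_completed[OF fin, of A, unfolded p(4)]]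
    show "W p \<in> sets \<Omega>" "measure (P A) (W p) \<le> exp lam * \<alpha>"
      using *(1)[where N=N and lam=lam] *(2)[where N=N and lam=lam] unfolding p(1) W_def by simp_all
  qed
  have dev_\<Omega>: "dev_ev i \<in> sets \<Omega>" if i: "i \<in> {1..M}" for i
  proof -
    have "\<xi> i m \<in> borel_measurable \<Omega>" for m
      using \<xi>_meas[of i m] measurable_from_subalg[of \<Omega> "full_history m"] full_events[of m]
      by (auto simp: subalgebra_def)
    moreover have "(\<lambda>\<omega>. log_lr A i (X i (Suc m) \<omega>)) \<in> borel_measurable \<Omega>" for m
      using measurable_compose[OF X_measurable[OF i] log_lr_measurable[OF i]] by auto
    ultimately show ?thesis unfolding dev_ev_def by measurable
  qed
  have I: "finite I" "card I \<le> 2 ^ M * 2 ^ M"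
  proof -
    have "I \<subseteq> Pow {1..M} \<times> Pow {1..M}" by (auto simp: I_def)
    moreover have "finite (Pow {1..M} \<times> Pow {1..M})" by simp
    moreover have "card (Pow {1..M} \<times> Pow {1..M}) = 2 ^ M * 2 ^ M"
      by (simp add: card_cartesian_product card_Pow)
    ultimately show "finite I" "card I \<le> 2 ^ M * 2 ^ M"
      by (metis finite_subset, metis card_mono)
  qed
  let ?bad = "err_ev \<union> (\<Union>p\<in>I. W p) \<union> (\<Union>i\<in>{1..M}. dev_ev i)"
  have cover: "AE \<omega> in P A. \<omega> \<in> {\<omega> \<in> space \<Omega>. T \<omega> \<le> enat N} \<longrightarrow> \<omega> \<in> ?bad"
    using budget AE_lr_eq_exp[OF A R]
  proof eventually_elim
    case (elim \<omega>)
    show ?case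
    proof (intro impI, rule ccontr)
      assume T: "\<omega> \<in> {\<omega> \<in> space \<Omega>. T \<omega> \<le> enat N}" and good: "\<omega> \<notin> ?bad"
      then have \<omega>: "\<omega> \<in> space \<Omega>" by simp
      obtain n where n: "T \<omega> = enat n" "n \<le> N"
        using T by (cases "T \<omega>") auto
      define D where "D = sym_diff A (\<Delta> \<omega>)"
      have D: "D \<subseteq> {1..M}" "\<Delta> \<omega> = sym_diff A D"
        using measurable_space[OF \<Delta> \<omega>] A by (auto simp: D_def)
      have large: "lam < (\<Sum>i\<in>U - D. \<Sum>m=1..n. if i \<in> R m \<omega> then log_lr A i (X i m \<omega>) else 0)"
        if U: "U \<subseteq> {1..M}" "card U = k" for U
      proof -
        have "(D, U) \<in> I" using D U by (auto simp: I_def)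
        then have "\<not> lr A (sym_diff A (U - D)) R n \<omega> \<le> ennreal (exp lam)"
          using good \<omega> n D(2) by (auto simp: W_def)
        moreover have "sym_diff A (U - D) \<subseteq> {1..M}" using A U by auto
        moreover have "sym_diff A (sym_diff A (U - D)) = U - D" by auto
        ultimately show ?thesis
          using elim(2)[rule_format, of "sym_diff A (U - D)" n] by simp
      qed
      (* At n = 0 nothing has been observed and the likelihood ratio is 1. *)
      have n1: "1 \<le> n"
      proof (rule ccontr)
        assume "\<not> 1 \<le> n"
        then show False
          using large[of "{1..k}"] k lam by simp
      qed
      have "R m \<omega> \<subseteq> {1..M}" if "m \<in> {1..n}" for m
        using sampling_rule_sets(2)[OF R \<omega>, of "m - 1"] that by simp
      then obtain U where U: "U \<subseteq> {1..M}" "card U = k"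
        "(\<Sum>i\<in>U. info A i * real (card {m\<in>{1..n}. i \<in> R m \<omega>})) \<le> real n * ?V"
        using path_information_bound[OF K k _ n1, of "\<lambda>m. R m \<omega>"] elim(1) n(1) n1 by blast
      have finU: "finite U" using U(1) finite_subset by auto
      have small: "(\<Sum>m=1..n. if i \<in> R m \<omega> then log_lr A i (X i m \<omega>) else 0)
          \<le> info A i * real (card {m\<in>{1..n}. i \<in> R m \<omega>}) + \<eta> * N" if i: "i \<in> U" for i
      proof -
        let ?g = "\<lambda>m. if i \<in> R m \<omega> then log_lr A i (X i m \<omega>) - info A i else 0"
        have "(\<Sum>m<N. \<xi> i m \<omega> * (log_lr A i (X i (Suc m) \<omega>) - info A i)) = (\<Sum>m<N. if m < n then ?g (Suc m) else 0)"
          using \<omega> n(1) by (intro sum.cong refl) (auto simp: \<xi>_def not_le)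
        also have "\<dots> = (\<Sum>m<n. ?g (Suc m))"
        proof -
          have "{..<N} \<inter> {..<n} = {..<n}" using n(2) by auto
          then show ?thesis
            using sum.inter_restrict[of "{..<N}" "\<lambda>m. ?g (Suc m)" "{..<n}"] by simp
        qed
        also have "\<dots> = (\<Sum>m=1..n. ?g m)"
          using sum.atLeast1_atMost_eq[of ?g n] by simp
        also have "\<dots> = (\<Sum>m=1..n. if i \<in> R m \<omega> then log_lr A i (X i m \<omega>) else 0)
            - (\<Sum>m=1..n. if i \<in> R m \<omega> then info A i else 0)"
          by (simp add: sum_subtractf[symmetric] if_distrib cong: if_cong)
        also have "(\<Sum>m=1..n. if i \<in> R m \<omega> then info A i else 0)
            = info A i * real (card {m\<in>{1..n}. i \<in> R m \<omega>})"
          by (simp add: sum.inter_filter[symmetric] mult.commute)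
        finally have eq: "(\<Sum>m<N. \<xi> i m \<omega> * (log_lr A i (X i (Suc m) \<omega>) - info A i))
          = (\<Sum>m=1..n. if i \<in> R m \<omega> then log_lr A i (X i m \<omega>) else 0)
            - info A i * real (card {m\<in>{1..n}. i \<in> R m \<omega>})" .
        have "\<omega> \<notin> dev_ev i" using good i U(1) by auto
        then show ?thesis using \<omega> eq by (simp add: dev_ev_def)
      qed
      have "lam < (\<Sum>i\<in>U - D. \<Sum>m=1..n. if i \<in> R m \<omega> then log_lr A i (X i m \<omega>) else 0)"
        by (rule large[OF U(1,2)])
      also have "\<dots> \<le> (\<Sum>i\<in>U - D. info A i * real (card {m\<in>{1..n}. i \<in> R m \<omega>}) + \<eta> * N)"
        using small by (intro sum_mono) auto
      also have "\<dots> \<le> (\<Sum>i\<in>U. info A i * real (card {m\<in>{1..n}. i \<in> R m \<omega>}) + \<eta> * N)"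
      proof (rule sum_mono2[OF finU])
        show "0 \<le> info A i * real (card {m\<in>{1..n}. i \<in> R m \<omega>}) + \<eta> * N" if "i \<in> U - (U - D)" for i
          using that U(1) dens_info(4)[of i A] \<eta> by auto
      qed auto
      also have "\<dots> = (\<Sum>i\<in>U. info A i * real (card {m\<in>{1..n}. i \<in> R m \<omega>})) + real k * (\<eta> * N)"
        using U(2) by (simp add: sum.distrib)
      also have "\<dots> \<le> real n * ?V + real M * (\<eta> * N)"
        using U(3) k \<eta> by (intro add_mono mult_right_mono) auto
      also have "\<dots> \<le> real N * ?V + real M * (\<eta> * N)"
      proof -
        have "0 \<le> (\<Sum>i\<in>U. info A i * real (card {m\<in>{1..n}. i \<in> R m \<omega>}))"
        proof (intro sum_nonneg mult_nonneg_nonneg)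
          show "0 \<le> info A i" if "i \<in> U" for i
            using dens_info(4)[of i A] U(1) that by auto
        qed auto
        then have "0 \<le> real n * ?V" using U(3) by linarith
        then have "0 \<le> ?V" using n1 by (simp add: zero_le_mult_iff)
        then show ?thesis using n(2) by (intro add_right_mono mult_right_mono) auto
      qed
      also have "\<dots> \<le> lam" by (rule N)
      finally show False by simp
    qed
  qed
  have W_UN: "(\<Union>p\<in>I. W p) \<in> sets (P A)" and dev_UN: "(\<Union>i\<in>{1..M}. dev_ev i) \<in> sets (P A)"
    and err_A: "err_ev \<in> sets (P A)"
    using W_bound(1) I(1) dev_\<Omega> err_\<Omega> sets_P[OF A] by (auto intro!: sets.finite_UN)
  have "measure (P A) {\<omega> \<in> space \<Omega>. T \<omega> \<le> enat N} \<le> measure (P A) ?bad"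
    using W_UN dev_UN err_A cover by (intro PA.finite_measure_mono_AE) auto
  also have "\<dots> \<le> measure (P A) (err_ev \<union> (\<Union>p\<in>I. W p)) + measure (P A) (\<Union>i\<in>{1..M}. dev_ev i)"
    using W_UN dev_UN err_A by (intro measure_Un_le) auto
  also have "\<dots> \<le> (measure (P A) err_ev + measure (P A) (\<Union>p\<in>I. W p)) + measure (P A) (\<Union>i\<in>{1..M}. dev_ev i)"
    using W_UN err_A by (intro add_right_mono measure_Un_le) auto
  also have "measure (P A) (\<Union>p\<in>I. W p) \<le> (\<Sum>p\<in>I. measure (P A) (W p))"
    using W_bound(1) I(1) sets_P[OF A] by (intro measure_UNION_le) auto
  also have "\<dots> \<le> (\<Sum>p\<in>I. exp lam * \<alpha>)"
    using W_bound(2) by (intro sum_mono)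
  also have "\<dots> \<le> 2 ^ M * 2 ^ M * (exp lam * \<alpha>)"
  proof -
    have "real (card I) \<le> real (2 ^ M * 2 ^ M)" using I(2) by (rule of_nat_mono)
    then show ?thesis using \<alpha> by (simp add: mult_right_mono)
  qed
  also have "measure (P A) (\<Union>i\<in>{1..M}. dev_ev i) \<le> (\<Sum>i\<in>{1..M}. measure (P A) (dev_ev i))"
    using dev_\<Omega> sets_P[OF A] by (intro measure_UNION_le) auto
  also have "\<dots> \<le> (\<Sum>i\<in>{1..M}. \<delta>)"
    unfolding dev_ev_def using dev \<xi>_meas \<xi>_le by (intro sum_mono) auto
  finally show "measure (P A) {\<omega> \<in> space \<Omega>. T \<omega> \<le> enat N}
      \<le> \<alpha> + 2 ^ M * 2 ^ M * (exp lam * \<alpha>) + real M * \<delta>"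
    using err unfolding err_ev_def by simp
qed

text \<open>Stated in terms of \<open>a = \<bar>ln \<alpha>\<bar>\<close>.  The threshold \<open>lam = (1 - \<epsilon>) a\<close> makes the change of measure cost
  \<open>exp lam * \<alpha> = exp (- \<epsilon> a)\<close>, which vanishes, and the time horizon \<open>(1 - 2 \<epsilon>) a / V\<close> leaves room \<open>\<epsilon> a\<close> for
  the deviations.\<close>

lemma early_stopping_vanishes:
  assumes A: "A \<subseteq> {1..M}" and K: "0 < K" "K \<le> real M" and k: "k \<in> {1..M}"
    and \<epsilon>: "0 < \<epsilon>" "\<epsilon> < 1 / 2" and \<delta>: "0 < \<delta>"
  shows "\<forall>\<^sub>F a in at_top. \<forall>(R, T, \<Delta>) \<in> admissible_policies M S \<Omega> P X Z (exp (- a)) k K.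
    {\<omega> \<in> space \<Omega>. T \<omega> \<le> enat (nat \<lfloor>(1 - 2 * \<epsilon>) * a / V M k K (F_list M \<nu> f0 f1 A)\<rfloor>)} \<in> sets \<Omega> \<and>
    measure (P A) {\<omega> \<in> space \<Omega>. T \<omega> \<le> enat (nat \<lfloor>(1 - 2 * \<epsilon>) * a / V M k K (F_list M \<nu> f0 f1 A)\<rfloor>)} \<le> \<delta>"
proof -
  define v where "v = V M k K (F_list M \<nu> f0 f1 A)"
  have v: "0 < v" unfolding v_def by (rule V_pos[OF K k])
  have M: "0 < real M" using M_pos by simp
  define \<eta> where "\<eta> = \<epsilon> * v / M"
  define \<delta>' where "\<delta>' = \<delta> / (3 * M)"
  have \<eta>: "0 < \<eta>" and \<delta>': "0 < \<delta>'" using \<epsilon> v M \<delta> by (auto simp: \<eta>_def \<delta>'_def)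
  let ?dev = "\<lambda>i N. \<forall>\<xi>. (\<forall>m. \<xi> m \<in> borel_measurable (full_history m)) \<and> (\<forall>m \<omega>. \<bar>\<xi> m \<omega>\<bar> \<le> 1) \<longrightarrow>
    measure (P A) {\<omega> \<in> space \<Omega>. \<eta> * real N \<le>
      (\<Sum>m<N. \<xi> m \<omega> * (log_lr A i (X i (Suc m) \<omega>) - info A i))} \<le> \<delta>'"
  have "\<forall>i\<in>{1..M}. \<exists>N0. \<forall>N\<ge>N0. ?dev i N"
    using sampled_llr_deviation[OF A _ \<eta> \<delta>'] by blast
  from bchoice[OF this] obtain N0 where N0_all: "\<forall>i\<in>{1..M}. \<forall>N\<ge>N0 i. ?dev i N" ..
  have N0: "?dev i N" if "i \<in> {1..M}" "N0 i \<le> N" for i N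
    using that(2) by (rule mp[OF spec[OF bspec[OF N0_all that(1)]]])
  define N1 where "N1 = Max (N0 ` {1..M})"
  have N1: "N0 i \<le> N1" if "i \<in> {1..M}" for i
    unfolding N1_def using that by (intro Max_ge) auto
  define a0 where "a0 = max 1 (max (real (Suc N1) * v / (1 - 2 * \<epsilon>))
     (max (- ln (\<delta> / 3)) (- ln (\<delta> / (3 * (2 ^ M * 2 ^ M))) / \<epsilon>)))"
  show ?thesis
  proof (rule eventually_mono[OF eventually_ge_at_top[of a0]], safe)
    fix a R T \<Delta>
    assume a: "a0 \<le> a" and adm: "(R, T, \<Delta>) \<in> admissible_policies M S \<Omega> P X Z (exp (- a)) k K"
    have a1: "1 \<le> a" and aN: "real (Suc N1) * v / (1 - 2 * \<epsilon>) \<le> a" and a\<delta>: "- ln (\<delta> / 3) \<le> a"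
      and a\<epsilon>: "- ln (\<delta> / (3 * (2 ^ M * 2 ^ M))) / \<epsilon> \<le> a"
      using a by (auto simp: a0_def)
    define N where "N = nat \<lfloor>(1 - 2 * \<epsilon>) * a / v\<rfloor>"
    have Nle: "real N \<le> (1 - 2 * \<epsilon>) * a / v"
      using a1 \<epsilon> v by (simp add: N_def)
    have "real (Suc N1) \<le> (1 - 2 * \<epsilon>) * a / v"
      using aN \<epsilon> v by (simp add: field_simps)
    then have NN1: "N1 \<le> N" unfolding N_def by linarith
    define lam where "lam = (1 - \<epsilon>) * a"
    have lam: "0 < lam" using a1 \<epsilon> by (simp add: lam_def)
    have Nv: "real N * v \<le> (1 - 2 * \<epsilon>) * a"
      using Nle v by (simp add: field_simps)
    have Nlam: "real N * v + real M * (\<eta> * real N) \<le> lam"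
    proof -
      have "real M * (\<eta> * real N) = \<epsilon> * (real N * v)"
        using M by (simp add: \<eta>_def)
      also have "\<dots> \<le> \<epsilon> * a"
      proof (rule mult_left_mono)
        have "0 \<le> 2 * \<epsilon> * a" using \<epsilon> a1 by simp
        then show "real N * v \<le> a" using Nv by (simp add: algebra_simps)
      qed (use \<epsilon> in simp)
      finally show ?thesis using Nv by (simp add: lam_def algebra_simps)
    qed
    have dev: "measure (P A) {\<omega> \<in> space \<Omega>. \<eta> * real N \<le>
        (\<Sum>m<N. \<xi> m \<omega> * (log_lr A i (X i (Suc m) \<omega>) - info A i))} \<le> \<delta>'"
      if i: "i \<in> {1..M}" and "\<And>m. \<xi> m \<in> borel_measurable (full_history m)" "\<And>m \<omega>. \<bar>\<xi> m \<omega>\<bar> \<le> 1" for i \<xi>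
      using N0[OF i, of N] N1[OF i] NN1 that(2,3) by auto
    note bound = early_stopping_bound[OF A adm K(1) k _ lam \<eta> Nlam[unfolded v_def] dev]
    show "{\<omega> \<in> space \<Omega>. T \<omega> \<le> enat (nat \<lfloor>(1 - 2 * \<epsilon>) * a / V M k K (F_list M \<nu> f0 f1 A)\<rfloor>)} \<in> sets \<Omega>"
      unfolding v_def[symmetric] N_def[symmetric] by (rule bound(1)) auto
    have *: "measure (P A) {\<omega> \<in> space \<Omega>. T \<omega> \<le> enat N}
        \<le> exp (- a) + 2 ^ M * 2 ^ M * (exp lam * exp (- a)) + real M * \<delta>'"
      by (rule bound(2)) auto
    have **: "exp (- a) \<le> \<delta> / 3"
    proof -
      have "- a \<le> ln (\<delta> / 3)" using a\<delta> by linarith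
      then have "exp (- a) \<le> exp (ln (\<delta> / 3))" by simp
      then show ?thesis using \<delta> by simp
    qed
    have ***: "2 ^ M * 2 ^ M * (exp lam * exp (- a)) \<le> \<delta> / 3"
    proof -
      have "- ln (\<delta> / (3 * (2 ^ M * 2 ^ M))) \<le> a * \<epsilon>"
        using a\<epsilon> \<epsilon>(1) by (simp only: pos_divide_le_eq)
      then have "- (\<epsilon> * a) \<le> ln (\<delta> / (3 * (2 ^ M * 2 ^ M)))"
        by (simp only: mult.commute minus_le_iff)
      then have "exp (- (\<epsilon> * a)) \<le> exp (ln (\<delta> / (3 * (2 ^ M * 2 ^ M))))" by (subst exp_le_cancel_iff)
      also have "\<dots> = \<delta> / (3 * (2 ^ M * 2 ^ M))" using \<delta> by (intro exp_ln) simp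
      finally have "exp (- (\<epsilon> * a)) \<le> \<delta> / (3 * (2 ^ M * 2 ^ M))" .
      moreover have "exp lam * exp (- a) = exp (- (\<epsilon> * a))"
        by (simp add: exp_add[symmetric] lam_def algebra_simps)
      ultimately show ?thesis by (simp add: field_simps)
    qed
    have "real M * \<delta>' = \<delta> / 3" using M by (simp add: \<delta>'_def)
    then show "measure (P A) {\<omega> \<in> space \<Omega>. T \<omega> \<le>
        enat (nat \<lfloor>(1 - 2 * \<epsilon>) * a / V M k K (F_list M \<nu> f0 f1 A)\<rfloor>)} \<le> \<delta>"
      unfolding v_def[symmetric] N_def[symmetric] using * ** *** by linarith
  qed
qed

lemma expected_time_bound:
  assumes A: "A \<subseteq> {1..M}" and x: "0 \<le> x"
    and T: "{\<omega> \<in> space \<Omega>. T \<omega> \<le> enat (nat \<lfloor>x\<rfloor>)} \<in> sets \<Omega>"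
    and small: "measure (P A) {\<omega> \<in> space \<Omega>. T \<omega> \<le> enat (nat \<lfloor>x\<rfloor>)} \<le> \<delta>"
  shows "ennreal ((1 - \<delta>) * x) \<le> (\<integral>\<^sup>+\<omega>. ennreal_of_enat (T \<omega>) \<partial>P A)"
proof -
  interpret PA: prob_space "P A" by (rule prob_space_P[OF A])
  let ?E = "{\<omega> \<in> space \<Omega>. T \<omega> \<le> enat (nat \<lfloor>x\<rfloor>)}"
  have E: "?E \<in> sets (P A)" using T sets_P[OF A] by simp
  have "(1 - \<delta>) * x \<le> x * measure (P A) (space (P A) - ?E)"
    using small x E by (subst PA.prob_compl) (auto intro: mult_left_mono simp: mult.commute)
  then have "ennreal ((1 - \<delta>) * x) \<le> ennreal x * emeasure (P A) (space (P A) - ?E)"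
    using x by (simp add: PA.emeasure_eq_measure ennreal_mult[symmetric] ennreal_leI)
  also have "\<dots> = (\<integral>\<^sup>+\<omega>. ennreal x * indicator (space (P A) - ?E) \<omega> \<partial>P A)"
    using E by (intro nn_integral_cmult_indicator[symmetric]) auto
  also have "\<dots> \<le> (\<integral>\<^sup>+\<omega>. ennreal_of_enat (T \<omega>) \<partial>P A)"
  proof (rule nn_integral_mono)
    fix \<omega> assume \<omega>: "\<omega> \<in> space (P A)"
    show "ennreal x * indicator (space (P A) - ?E) \<omega> \<le> ennreal_of_enat (T \<omega>)"
    proof (cases "\<omega> \<in> ?E")
      case False
      then have gt: "enat (nat \<lfloor>x\<rfloor>) < T \<omega>" using \<omega> space_P[OF A] by auto
      have "ennreal x \<le> ennreal_of_enat (T \<omega>)"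
      proof (cases "T \<omega>")
        case (enat n)
        then have "x \<le> real n" using gt by simp linarith
        then show ?thesis
          unfolding enat by (simp add: ennreal_of_nat_eq_real_of_nat ennreal_leI)
      qed simp
      then show ?thesis using False \<omega> by simp
    qed simp
  qed
  finally show ?thesis .
qed

end

section \<open>The asymptotic lower bound\<close>

theorem mainTheorem1:
  fixes M k :: nat
    and K :: real
    and A :: "nat set"
    and S :: "'s measure"
    and \<nu> :: "nat \<Rightarrow> 's measure"
    and f0 f1 :: "nat \<Rightarrow> 's \<Rightarrow> real"
    and \<Omega> :: "'w measure"
    and P :: "nat set \<Rightarrow> 'w measure"
    and X :: "nat \<Rightarrow> nat \<Rightarrow> 'w \<Rightarrow> 's"
    and Z :: "nat \<Rightarrow> nat \<Rightarrow> 'w \<Rightarrow> real"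
  assumes "anomaly_model M S \<nu> f0 f1 \<Omega> P X Z"
    and "0 < K" and "K \<le> real M"
    and "k \<in> {1..M}"
    and "A \<subseteq> {1..M}"
    and "(\<Sum>i = 1..M. \<integral>\<^sup>+x. e2ennreal (\<bar>llr (f1 i) (f0 i) x\<bar> * elog_plus \<bar>llr (f1 i) (f0 i) x\<bar> * ereal (f1 i x)) \<partial>\<nu> i) < \<infinity>"
    and "(\<Sum>i = 1..M. \<integral>\<^sup>+x. e2ennreal (\<bar>llr (f1 i) (f0 i) x\<bar> * elog_plus \<bar>llr (f1 i) (f0 i) x\<bar> * ereal (f0 i x)) \<partial>\<nu> i) < \<infinity>"
  shows "1 \<le> Liminf (at_right 0)
           (\<lambda>\<alpha>. optimal_time M S \<Omega> P X Z A \<alpha> k K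
                  / ennreal (\<bar>ln \<alpha>\<bar> / V M k K (F_list M \<nu> f0 f1 A)))"
proof -
  interpret anomaly_model M S \<nu> f0 f1 \<Omega> P X Z by (rule assms(1))
  note K = assms(2,3) and k = assms(4) and A = assms(5)
  define v where "v = V M k K (F_list M \<nu> f0 f1 A)"
  have v: "0 < v" unfolding v_def by (rule V_pos[OF K k])
  show ?thesis
    unfolding le_Liminf_iff
  proof (intro allI impI)
    fix y :: ennreal assume y1: "y < 1"
    then obtain r where r: "y = ennreal r" "0 \<le> r" "r < 1"
      by (cases y) (auto simp: ennreal_less_one_iff)
    define \<epsilon> where "\<epsilon> = (1 - r) / 4"
    have \<epsilon>: "0 < \<epsilon>" "\<epsilon> < 1 / 2" using r by (auto simp: \<epsilon>_def)
    have "r < 1 - 3 * \<epsilon>" using r by (simp add: \<epsilon>_def field_simps)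
    also have "1 - 3 * \<epsilon> \<le> (1 - \<epsilon>) * (1 - 2 * \<epsilon>)" using \<epsilon> by (simp add: algebra_simps)
    finally have r_less: "r < (1 - \<epsilon>) * (1 - 2 * \<epsilon>)" .
    have "\<forall>\<^sub>F a in at_top. 1 \<le> a \<and> (\<forall>(R, T, \<Delta>) \<in> admissible_policies M S \<Omega> P X Z (exp (- a)) k K.
      {\<omega> \<in> space \<Omega>. T \<omega> \<le> enat (nat \<lfloor>(1 - 2 * \<epsilon>) * a / v\<rfloor>)} \<in> sets \<Omega> \<and>
      measure (P A) {\<omega> \<in> space \<Omega>. T \<omega> \<le> enat (nat \<lfloor>(1 - 2 * \<epsilon>) * a / v\<rfloor>)} \<le> \<epsilon>)"
      by (intro eventually_conj eventually_ge_at_top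
          early_stopping_vanishes[OF A K k \<epsilon> \<epsilon>(1), folded v_def])
    moreover have "filterlim (\<lambda>\<alpha>::real. - ln \<alpha>) at_top (at_right 0)"
      using ln_at_0 by (simp add: filterlim_uminus_at_bot)
    ultimately have "\<forall>\<^sub>F \<alpha> in at_right 0. 1 \<le> - ln \<alpha> \<and>
      (\<forall>(R, T, \<Delta>) \<in> admissible_policies M S \<Omega> P X Z (exp (- (- ln \<alpha>))) k K.
      {\<omega> \<in> space \<Omega>. T \<omega> \<le> enat (nat \<lfloor>(1 - 2 * \<epsilon>) * (- ln \<alpha>) / v\<rfloor>)} \<in> sets \<Omega> \<and>
      measure (P A) {\<omega> \<in> space \<Omega>. T \<omega> \<le> enat (nat \<lfloor>(1 - 2 * \<epsilon>) * (- ln \<alpha>) / v\<rfloor>)} \<le> \<epsilon>)"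
      by (rule eventually_compose_filterlim)
    then show "\<forall>\<^sub>F \<alpha> in at_right 0. y < optimal_time M S \<Omega> P X Z A \<alpha> k K
        / ennreal (\<bar>ln \<alpha>\<bar> / V M k K (F_list M \<nu> f0 f1 A))"
      using eventually_at_right_less[of 0]
    proof eventually_elim
      case (elim \<alpha>)
      define a where "a = - ln \<alpha>"
      have a: "1 \<le> a" "\<bar>ln \<alpha>\<bar> = a" "exp (- a) = \<alpha>" using elim by (auto simp: a_def)
      have av: "0 < a / v" using a v by simp
      have "ennreal ((1 - \<epsilon>) * (1 - 2 * \<epsilon>) * (a / v)) \<le> optimal_time M S \<Omega> P X Z A \<alpha> k K"
        unfolding optimal_time_def
      proof (rule INF_greatest, safe)
        fix R T \<Delta> assume "(R, T, \<Delta>) \<in> admissible_policies M S \<Omega> P X Z \<alpha> k K"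
        then have T: "{\<omega> \<in> space \<Omega>. T \<omega> \<le> enat (nat \<lfloor>(1 - 2 * \<epsilon>) * a / v\<rfloor>)} \<in> sets \<Omega>"
          "measure (P A) {\<omega> \<in> space \<Omega>. T \<omega> \<le> enat (nat \<lfloor>(1 - 2 * \<epsilon>) * a / v\<rfloor>)} \<le> \<epsilon>"
          using elim(1) a(3) unfolding a_def by auto
        have "0 \<le> (1 - 2 * \<epsilon>) * a / v" using a v \<epsilon> by simp
        from expected_time_bound[OF A this T]
        show "ennreal ((1 - \<epsilon>) * (1 - 2 * \<epsilon>) * (a / v)) \<le> (\<integral>\<^sup>+\<omega>. ennreal_of_enat (T \<omega>) \<partial>P A)"
          by (simp add: mult.assoc)
      qed
      then have "ennreal ((1 - \<epsilon>) * (1 - 2 * \<epsilon>) * (a / v)) / ennreal (a / v)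
          \<le> optimal_time M S \<Omega> P X Z A \<alpha> k K / ennreal (a / v)"
        by (rule divide_right_mono_ennreal)
      moreover have "ennreal ((1 - \<epsilon>) * (1 - 2 * \<epsilon>) * (a / v)) / ennreal (a / v) = ennreal ((1 - \<epsilon>) * (1 - 2 * \<epsilon>))"
      proof (subst divide_ennreal)
        show "0 \<le> (1 - \<epsilon>) * (1 - 2 * \<epsilon>) * (a / v)"
          using av \<epsilon> by (intro mult_nonneg_nonneg) auto
      qed (use a v in auto)
      moreover have "y < ennreal ((1 - \<epsilon>) * (1 - 2 * \<epsilon>))"
        unfolding r(1) using r_less r(2) by (simp add: ennreal_less_iff)
      ultimately show ?case
        unfolding v_def[symmetric] a(2) by simp
    qed
  qed
qed

end
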